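(* Let $n\ge 1$ be an integer and let $B$ be a skew brace such that $B/\operatorname{Z}_n(B)$ is finite. If $n>1$, suppose in addition that $[B,B]^B\subseteq\ker\lambda$. Then $\Gamma_{n+1}(B)$ is finite.
   Context: A skew (left) brace $(B,+,\cdot)$ is a set $B$ with two group structures $(B,+)$ and $(B,\cdot)$ (neither assumed abelian or finite) such that $a(b+c)=ab-a+ac$ for all $a,b,c\in B$; the two groups share the identity element $0$. Put $a*b=-a+ab-b$ and $\lambda_a(b)=-a+ab$; $a\mapsto\lambda_a$ is a homomorphism $(B,\cdot)\to\operatorname{Aut}(B,+)$. For $X,Y\subseteq B$, $X*Y$ is the subgroup of $(B,+)$ generated by $\{x*y\mid x\in X,y\in Y\}$, and $[X,Y]_+$, $[X,Y]_\bullet$ are the commutator subgroups of $X$ and $Y$ in $(B,+)$ and $(B,\cdot)$, respectively. A subbrace is a subset that is a subgroup of both $(B,+)$ and $(B,\cdot)$. An ideal is a subbrace $I$ with $(I,+)$ normal in $(B,+)$, $B*I\subseteq I$ and $I*B\subseteq I$; then the quotient skew brace $B/I$ is defined. $\langle X\rangle^B$ is the smallest ideal of $B$ containing $X$. For ideals $I,J$, $[I,J]^B=\langle [I,J]_+\cup[I,J]_\bullet\cup\{ij-(i+j)\mid i\in I,j\in J\}\rangle^B$; the derived ideal of $B$ is $[B,B]^B$. The lower central series is $\Gamma_1(B)=B$, $\Gamma_{n+1}(B)=[\Gamma_n(B),B]^B$ for $n\ge1$. $\ker\lambda=\{a\in B\mid \lambda_a(b)=b\ \forall b\in B\}$, and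 the centre is the ideal $\operatorname{Z}(B)=\ker\lambda\cap \operatorname{Z}(B,+)\cap \operatorname{Z}(B,\cdot)$, where $\operatorname{Z}(B,+)$ and $\operatorname{Z}(B,\cdot)$ are the centres of the two groups. The upper central series is $\operatorname{Z}_0(B)=0$, $\operatorname{Z}_{n+1}(B)/\operatorname{Z}_n(B)=\operatorname{Z}(B/\operatorname{Z}_n(B))$. *)

theory Defs
  imports "HOL-Algebra.QuotRing" "HOL-Algebra.Generated_Groups"
begin

text \<open>
  A skew brace is represented by the record type \<open>ring\<close> of HOL-Algebra, used only as a carrier set
  with two operations: \<open>add_monoid B\<close> is the group \<open>(B,+)\<close>, which need not be abelian, and \<open>B\<close>
  itself (read as a monoid) is the group \<open>(B,\<cdot>)\<close>. No ring axiom is assumed. The compatibility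
  condition forces \<open>\<zero> = \<one>\<close> (take \<open>b = c = \<zero>\<close>; see \<open>skew_brace.zero_eq_one\<close>).
\<close>

locale skew_brace =
  fixes B (structure)
  assumes add_group: "group (add_monoid B)"
    and mult_group: "group B"
    and compat: "\<lbrakk> a \<in> carrier B; b \<in> carrier B; c \<in> carrier B \<rbrakk>
      \<Longrightarrow> a \<otimes> (b \<oplus> c) = ((a \<otimes> b) \<ominus> a) \<oplus> (a \<otimes> c)"

lemma (in skew_brace) zero_eq_one: "\<zero> = \<one>"
proof -
  interpret A: group "add_monoid B" by (rule add_group)
  interpret M: group B by (rule mult_group)
  have z: "\<zero> \<in> carrier B" using A.one_closed by simp
  have o: "\<one> \<in> carrier B" by simp
  have zz: "\<zero> \<oplus> \<zero> = \<zero>" using A.l_one[of "\<zero>"] z by simp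
  have inv0: "\<one> \<oplus> (\<ominus> \<one>) = \<zero>" using A.r_inv[of "\<one>"] o by (simp add: a_inv_def)
  have invc: "\<ominus> \<one> \<in> carrier B" using A.inv_closed[of "\<one>"] o by (simp add: a_inv_def)
  have "\<one> \<otimes> (\<one> \<oplus> \<zero>) = \<one>" using A.r_one[of "\<one>"] o by simp
  have "\<one> \<otimes> (\<zero> \<oplus> \<zero>) = ((\<one> \<otimes> \<zero>) \<ominus> \<one>) \<oplus> (\<one> \<otimes> \<zero>)"
    by (rule compat[OF o z z])
  hence "\<zero> = ((\<zero> \<oplus> (\<ominus> \<one>)) \<oplus> \<zero>)" using zz z by (simp add: a_minus_def)
  also have "\<dots> = \<ominus> \<one>" using A.l_one[of "\<ominus> \<one>"] A.r_one[of "\<ominus> \<one>"] invc by simp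
  finally have "\<ominus> \<one> = \<zero>" by simp
  thus ?thesis using inv0 A.r_one[of "\<one>"] o by simp
qed

definition brace_star :: "('a, 'm) ring_scheme \<Rightarrow> 'a \<Rightarrow> 'a \<Rightarrow> 'a"
  where "brace_star B a b = ((\<ominus>\<^bsub>B\<^esub> a) \<oplus>\<^bsub>B\<^esub> (a \<otimes>\<^bsub>B\<^esub> b)) \<ominus>\<^bsub>B\<^esub> b"

definition brace_lambda :: "('a, 'm) ring_scheme \<Rightarrow> 'a \<Rightarrow> 'a \<Rightarrow> 'a"
  where "brace_lambda B a b = (\<ominus>\<^bsub>B\<^esub> a) \<oplus>\<^bsub>B\<^esub> (a \<otimes>\<^bsub>B\<^esub> b)"

definition star_set :: "('a, 'm) ring_scheme \<Rightarrow> 'a set \<Rightarrow> 'a set \<Rightarrow> 'a set"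
  where "star_set B X Y = generate (add_monoid B) {brace_star B x y | x y. x \<in> X \<and> y \<in> Y}"

text \<open>The library's \<open>derived\<close> is the case \<open>X = Y\<close>; the convention for commutators is the same.\<close>

definition commutator_subgroup :: "('a, 'm) monoid_scheme \<Rightarrow> 'a set \<Rightarrow> 'a set \<Rightarrow> 'a set"
  where "commutator_subgroup G X Y =
    generate G {x \<otimes>\<^bsub>G\<^esub> y \<otimes>\<^bsub>G\<^esub> inv\<^bsub>G\<^esub> x \<otimes>\<^bsub>G\<^esub> inv\<^bsub>G\<^esub> y | x y. x \<in> X \<and> y \<in> Y}"

definition subbrace :: "'a set \<Rightarrow> ('a, 'm) ring_scheme \<Rightarrow> bool"
  where "subbrace S B \<longleftrightarrow> subgroup S (add_monoid B) \<and> subgroup S B"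

definition brace_ideal :: "'a set \<Rightarrow> ('a, 'm) ring_scheme \<Rightarrow> bool"
  where "brace_ideal I B \<longleftrightarrow> subbrace I B \<and> I \<lhd> add_monoid B
    \<and> star_set B (carrier B) I \<subseteq> I \<and> star_set B I (carrier B) \<subseteq> I"

definition ideal_generated :: "('a, 'm) ring_scheme \<Rightarrow> 'a set \<Rightarrow> 'a set"
  where "ideal_generated B X = \<Inter>{I. brace_ideal I B \<and> X \<subseteq> I}"

definition ideal_commutator :: "('a, 'm) ring_scheme \<Rightarrow> 'a set \<Rightarrow> 'a set \<Rightarrow> 'a set"
  where "ideal_commutator B I J = ideal_generated B
    (commutator_subgroup (add_monoid B) I J \<union> commutator_subgroup B I J
      \<union> {(i \<otimes>\<^bsub>B\<^esub> j) \<ominus>\<^bsub>B\<^esub> (i \<oplus>\<^bsub>B\<^esub> j) | i j. i \<in> I \<and> j \<in> J})"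

definition derived_ideal :: "('a, 'm) ring_scheme \<Rightarrow> 'a set"
  where "derived_ideal B = ideal_commutator B (carrier B) (carrier B)"

text \<open>Indexed from 1; the value at 0 is a dummy.\<close>

fun lower_central :: "('a, 'm) ring_scheme \<Rightarrow> nat \<Rightarrow> 'a set"
  where
    "lower_central B 0 = carrier B"
  | "lower_central B (Suc 0) = carrier B"
  | "lower_central B (Suc (Suc n)) = ideal_commutator B (lower_central B (Suc n)) (carrier B)"

definition ker_lambda :: "('a, 'm) ring_scheme \<Rightarrow> 'a set"
  where "ker_lambda B = {a \<in> carrier B. \<forall>b \<in> carrier B. brace_lambda B a b = b}"

definition group_center :: "('a, 'm) monoid_scheme \<Rightarrow> 'a set"
  where "group_center G = {z \<in> carrier G. \<forall>g \<in> carrier G. z \<otimes>\<^bsub>G\<^esub> g = g \<otimes>\<^bsub>G\<^esub> z}"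

definition brace_center :: "('a, 'm) ring_scheme \<Rightarrow> 'a set"
  where "brace_center B = ker_lambda B \<inter> group_center (add_monoid B) \<inter> group_center B"

text \<open>
  The quotient \<open>B/I\<close> is the library's \<open>B Quot I\<close>. Its definition makes sense without the ring
  axioms: the carrier consists of the additive cosets of \<open>I\<close>, addition is the set sum, and the
  product of \<open>I + a\<close> and \<open>I + b\<close> is the union of the cosets \<open>I + a'b'\<close> with \<open>a' \<in> I + a\<close> and
  \<open>b' \<in> I + b\<close>. For an ideal \<open>I\<close> of a skew brace additive and multiplicative cosets coincide, so
  this union is the single coset \<open>I + ab\<close>.
  Below, \<open>Z\<^sub>n\<^sub>+\<^sub>1\<close> is the preimage in \<open>B\<close> of the centre of \<open>B/Z\<^sub>n\<close>.
\<close>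

primrec upper_central :: "('a, 'm) ring_scheme \<Rightarrow> nat \<Rightarrow> 'a set"
  where
    "upper_central B 0 = {\<zero>\<^bsub>B\<^esub>}"
  | "upper_central B (Suc n) =
      {x \<in> carrier B. upper_central B n +>\<^bsub>B\<^esub> x \<in> brace_center (B Quot upper_central B n)}"

end

theory Submission
  imports Defs
begin

text \<open>
  The group \<open>(B,\<cdot>)\<close> acts on \<open>(B,+)\<close> through \<open>\<lambda>\<close>, and the semidirect product
  \<open>G = (B,+) \<rtimes> (B,\<cdot>)\<close> turns the statement about skew braces into one about groups: Baer's theorem
  that \<open>\<gamma>\<^sub>n\<^sub>+\<^sub>1(G)\<close> is finite as soon as some central chain of \<open>G\<close> has an \<open>n\<close>-th term of finite index.

  On the side of the centres there is nothing to lose. An element of \<open>Z\<^sub>i\<^sub>+\<^sub>1(B)\<close> is, modulo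
  \<open>Z\<^sub>i(B)\<close>, central for both operations, acts trivially and is fixed by the action. Hence the
  subgroups \<open>Z\<^sub>i(B) \<times> Z\<^sub>i(B)\<close> form a central chain of \<open>G\<close>
  (\<open>semidirect_central_chain\<close>), and if \<open>B/Z\<^sub>n(B)\<close> is finite then its \<open>n\<close>-th term has finite index.

  On the side of the commutators one needs \<open>\<Gamma>\<^sub>n\<^sub>+\<^sub>1(B) \<times> 0 \<subseteq> \<gamma>\<^sub>n\<^sub>+\<^sub>1(G)\<close>. For \<open>n = 1\<close> this always
  holds: \<open>\<gamma>\<^sub>2(G)\<close> contains all \<open>(a * b, 0)\<close> and all additive commutators, so its trace on \<open>(B,+)\<close> is an
  ideal modulo which the two operations coincide and commute
  (\<open>derived_ideal_subset_additive_series\<close>). For larger \<open>n\<close> the trace of \<open>\<gamma>\<^sub>n\<^sub>+\<^sub>1(G)\<close> has no reason to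
  be an ideal, because \<open>i * b\<close> need not lie in it. If the derived ideal is contained in \<open>ker \<lambda>\<close>, then
  \<open>i * b = 0\<close> for its elements \<open>i\<close>, the trace intersected with the derived ideal is an ideal, and
  the multiplicative commutator of \<open>i\<close> and \<open>b\<close> is the commutator of \<open>(i,0)\<close> and \<open>(b,b)\<close> in \<open>G\<close>
  (\<open>lower_central_subset_additive_series\<close>).

  Baer's theorem is proved by showing for \<open>k = 0, \<dots>, n\<close> that \<open>\<gamma>\<^sub>k\<^sub>+\<^sub>1(G)\<close> is finite modulo the
  \<open>(n - k)\<close>-th term \<open>Z\<^sub>n\<^sub>-\<^sub>k\<close> of the chain (\<open>finite_modulo_step\<close>). Modulo \<open>Z\<^sub>n\<^sub>-\<^sub>k\<^sub>-\<^sub>1\<close> the group \<open>Z\<^sub>n\<^sub>-\<^sub>k\<close> is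
  central, and \<open>Z\<^sub>n\<close> centralises \<open>\<gamma>\<^sub>k\<^sub>+\<^sub>1(G)\<close>; so there are only finitely many commutators \<open>[x,g]\<close>
  with \<open>x \<in> \<gamma>\<^sub>k\<^sub>+\<^sub>1(G)\<close>, and every such \<open>x\<close> has a central power. An identity of Rosenlicht, which
  writes a suitable power \<open>[x,g]\<^sup>m\<^sup>+\<^sup>1\<close> as a product of only \<open>m\<close> commutators, then bounds the length of the
  words needed to reach all of \<open>[\<gamma>\<^sub>k\<^sub>+\<^sub>1(G), G]\<close> (\<open>finite_commutator_subgroup\<close>).
\<close>

section \<open>Groups generated by finitely many commutators\<close>

context group
begin

lemma cancel_inv_left:
  assumes "x \<in> carrier G" "y \<in> carrier G"
  shows "inv x \<otimes> (x \<otimes> y) = y" "x \<otimes> (inv x \<otimes> y) = y"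
  using assms by (simp_all add: m_assoc[symmetric])

abbreviation list_product :: "'a list \<Rightarrow> 'a"
  where "list_product xs \<equiv> foldr (\<otimes>) xs \<one>"

lemma list_product_closed [simp, intro]:
  "set xs \<subseteq> carrier G \<Longrightarrow> list_product xs \<in> carrier G"
  by (induction xs) auto

lemma list_product_append:
  "set xs \<subseteq> carrier G \<Longrightarrow> set ys \<subseteq> carrier G \<Longrightarrow>
    list_product (xs @ ys) = list_product xs \<otimes> list_product ys"
  by (induction xs) (auto simp: m_assoc)

lemma list_product_replicate:
  "x \<in> carrier G \<Longrightarrow> list_product (replicate k x) = x [^] k"
proof (induction k)
  case (Suc k)
  then show ?case using nat_pow_Suc2[of x k] by simp
qed simp

text \<open>
  Moving a letter \<open>s\<close> to the front of a word conjugates the letters that it passes. The alphabet is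
  closed under conjugation, so the length of the word is unaffected.
\<close>

lemma list_product_collect_letter:
  assumes S: "S \<subseteq> carrier G" "\<And>g t. g \<in> carrier G \<Longrightarrow> t \<in> S \<Longrightarrow> g \<otimes> t \<otimes> inv g \<in> S"
    and s: "s \<in> S"
  shows "set xs \<subseteq> S \<Longrightarrow> r \<le> count_list xs s \<Longrightarrow>
    \<exists>ys. set ys \<subseteq> S \<and> length ys + r = length xs \<and> list_product xs = s [^] r \<otimes> list_product ys"
proof (induction xs arbitrary: r)
  case Nil
  then show ?case by auto
next
  case (Cons x xs)
  have sc: "s \<in> carrier G" "x \<in> carrier G" using s S Cons.prems by auto
  show ?case
  proof (cases r)
    case 0
    have "list_product (x # xs) \<in> carrier G"
      using Cons.prems S by (intro list_product_closed) auto
    then show ?thesis using Cons.prems 0 by (intro exI[of _ "x # xs"]) auto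
  next
    case (Suc r')
    show ?thesis
    proof (cases "x = s")
      case True
      then have "r' \<le> count_list xs s" using Cons.prems Suc by simp
      then obtain ys where ys: "set ys \<subseteq> S" "length ys + r' = length xs"
        "list_product xs = s [^] r' \<otimes> list_product ys"
        using Cons.IH[of r'] Cons.prems by auto
      have P: "list_product ys \<in> carrier G" using ys S by auto
      have "s [^] r = s \<otimes> s [^] r'" using sc nat_pow_Suc2 Suc by blast
      then have "list_product (x # xs) = s [^] r \<otimes> list_product ys"
        using ys sc True P by (simp add: m_assoc)
      then show ?thesis using ys Suc by auto
    next
      case False
      then have "r \<le> count_list xs s" using Cons.prems by simp
      then obtain ys where ys: "set ys \<subseteq> S" "length ys + r = length xs"
        "list_product xs = s [^] r \<otimes> list_product ys"
        using Cons.IH[of r] Cons.prems by auto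
      \<comment> \<open>the letter that arises when \<open>s [^] r\<close> moves past \<open>x\<close>\<close>
      let ?x' = "inv (s [^] r) \<otimes> x \<otimes> s [^] r"
      have P: "list_product ys \<in> carrier G" using ys S by auto
      have "?x' \<in> S" using S(2)[of "inv (s [^] r)" x] sc Cons.prems by simp
      moreover have "list_product (x # xs) = s [^] r \<otimes> list_product (?x' # ys)"
        using ys sc P by (simp add: m_assoc cancel_inv_left)
      ultimately show ?thesis using ys by (intro exI[of _ "?x' # ys"]) auto
    qed
  qed
qed

text \<open>
  By the pigeonhole principle, a word longer than \<open>\<Sum>s\<in>S. m s\<close> contains some letter \<open>s\<close> more than
  \<open>m s\<close> times. Collecting \<open>Suc (m s)\<close> of these occurrences at the front and replacing them by \<open>m s\<close>
  letters yields a shorter word for the same element.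
\<close>

lemma finite_generate_if_powers_shorten:
  fixes m :: "'a \<Rightarrow> nat"
  assumes S: "S \<subseteq> carrier G" "\<And>g t. g \<in> carrier G \<Longrightarrow> t \<in> S \<Longrightarrow> g \<otimes> t \<otimes> inv g \<in> S"
    and invS: "\<And>t. t \<in> S \<Longrightarrow> inv t \<in> S"
    and fin: "finite S"
    and shorten: "\<And>s. s \<in> S \<Longrightarrow>
      \<exists>zs. set zs \<subseteq> S \<and> length zs = m s \<and> list_product zs = s [^] Suc (m s)"
  shows "finite (generate G S)"
proof -
  let ?M = "\<Sum>s\<in>S. m s"
  have short: "\<exists>ys. set ys \<subseteq> S \<and> length ys \<le> ?M \<and> list_product ys = list_product xs"
    if "set xs \<subseteq> S" for xs
    using that
  proof (induction "length xs" arbitrary: xs rule: less_induct)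
    case less
    show ?case
    proof (cases "length xs \<le> ?M")
      case True
      then show ?thesis using less.prems by blast
    next
      case False
      have "sum (count_list xs) S = length xs"
        using sum_count_set[OF less.prems fin] .
      then obtain s where s: "s \<in> S" "m s < count_list xs s"
        using False sum_mono[of S "count_list xs" m] by (metis linorder_not_le)
      obtain ys where ys: "set ys \<subseteq> S" "length ys + Suc (m s) = length xs"
        "list_product xs = s [^] Suc (m s) \<otimes> list_product ys"
        using list_product_collect_letter[OF S s(1) less.prems, of "Suc (m s)"] s(2) by auto
      obtain zs where zs: "set zs \<subseteq> S" "length zs = m s" "list_product zs = s [^] Suc (m s)"
        using shorten[OF s(1)] by blast
      have "list_product (zs @ ys) = list_product xs"
        using list_product_append[of zs ys] zs ys S by auto
      moreover have "length (zs @ ys) < length xs" "set (zs @ ys) \<subseteq> S" using ys zs by auto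
      ultimately show ?thesis using less.hyps[of "zs @ ys"] by auto
    qed
  qed
  have word: "\<exists>xs. set xs \<subseteq> S \<and> list_product xs = x" if "x \<in> generate G S" for x
    using that
  proof (induction rule: generate.induct)
    case one
    show ?case by (intro exI[of _ "[]"]) auto
  next
    case (incl h)
    then show ?case using S by (intro exI[of _ "[h]"]) auto
  next
    case (inv h)
    then show ?case using S invS by (intro exI[of _ "[inv h]"]) auto
  next
    case (eng h1 h2)
    then obtain xs ys where "set xs \<subseteq> S" "list_product xs = h1" "set ys \<subseteq> S" "list_product ys = h2"
      by blast
    then show ?case using list_product_append[of xs ys] S by (intro exI[of _ "xs @ ys"]) auto
  qed
  have "generate G S \<subseteq> list_product ` {xs. set xs \<subseteq> S \<and> length xs \<le> ?M}"
  proof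
    fix x assume "x \<in> generate G S"
    then obtain xs where "set xs \<subseteq> S" "list_product xs = x" using word by blast
    then obtain ys where "set ys \<subseteq> S" "length ys \<le> ?M" "list_product ys = x"
      using short by blast
    then show "x \<in> list_product ` {xs. set xs \<subseteq> S \<and> length xs \<le> ?M}" by blast
  qed
  then show ?thesis using finite_lists_length_le[OF fin] finite_surj by blast
qed

abbreviation commutator :: "'a \<Rightarrow> 'a \<Rightarrow> 'a"
  where "commutator x y \<equiv> x \<otimes> y \<otimes> inv x \<otimes> inv y"

lemma commutator_conj:
  assumes "x \<in> carrier G" "y \<in> carrier G" "g \<in> carrier G"
  shows "g \<otimes> commutator x y \<otimes> inv g = commutator (g \<otimes> x \<otimes> inv g) (g \<otimes> y \<otimes> inv g)"
  using assms by (simp add: m_assoc inv_mult_group cancel_inv_left)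

lemma inv_commutator:
  assumes "x \<in> carrier G" "y \<in> carrier G"
  shows "inv (commutator x y) = commutator (inv x) (x \<otimes> y \<otimes> inv x)"
  using assms by (simp add: m_assoc inv_mult_group cancel_inv_left)

text \<open>
  Rosenlicht's identity. Since \<open>s [^] Suc k\<close> is central, conjugating it by \<open>y\<close> changes nothing, and
  the last conjugated factor merges with the remaining \<open>s\<close>:
  \<open>y\<^sup>-\<^sup>1[x,y]y \<cdot> [x,y] = y\<^sup>-\<^sup>1[x,y\<^sup>2]y\<close>. In this way \<open>k + 2\<close> commutators become \<open>k + 1\<close>.
\<close>

lemma commutator_power_shorten:
  assumes x: "x \<in> carrier G" and y: "y \<in> carrier G" and s: "s = commutator x y"
    and central: "\<And>g. g \<in> carrier G \<Longrightarrow> s [^] Suc k \<otimes> g = g \<otimes> s [^] Suc k"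
  shows "s [^] Suc (Suc k) =
    commutator (inv y \<otimes> x \<otimes> y) y [^] k \<otimes> commutator (inv y \<otimes> x \<otimes> y) (y \<otimes> y)"
proof -
  let ?t = "inv y \<otimes> s \<otimes> y"
  have sc: "s \<in> carrier G" using x y s by auto
  have tp: "?t [^] i = inv y \<otimes> s [^] i \<otimes> y" for i :: nat
    by (induction i) (use sc y in \<open>auto simp: m_assoc cancel_inv_left\<close>)
  have "s [^] Suc (Suc k) = s [^] Suc k \<otimes> s" by simp
  also have "s [^] Suc k = inv y \<otimes> s [^] Suc k \<otimes> y"
    using central[OF y] sc y nat_pow_closed[OF sc, of "Suc k"]
    by (simp add: m_assoc cancel_inv_left del: nat_pow_Suc)
  also have "\<dots> = ?t [^] Suc k" by (simp only: tp)
  also have "?t [^] Suc k \<otimes> s = ?t [^] k \<otimes> (?t \<otimes> s)" using sc y by (simp add: m_assoc)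
  also have "?t = commutator (inv y \<otimes> x \<otimes> y) y"
    using x y s by (simp add: m_assoc inv_mult_group cancel_inv_left)
  also have "commutator (inv y \<otimes> x \<otimes> y) y \<otimes> s = commutator (inv y \<otimes> x \<otimes> y) (y \<otimes> y)"
    using x y s by (simp add: m_assoc inv_mult_group cancel_inv_left)
  finally show ?thesis .
qed

text \<open>
  The case \<open>N = G\<close> contains Schur's theorem: if the centre has finite index, then there are
  only finitely many commutators and every element has a central power.
\<close>

lemma finite_commutator_subgroup:
  assumes N: "N \<lhd> G"
    and fin: "finite {commutator x y | x y. x \<in> N \<and> y \<in> carrier G}"
    and power: "\<And>x. x \<in> N \<Longrightarrow> \<exists>k::nat. \<forall>g\<in>carrier G. x [^] Suc k \<otimes> g = g \<otimes> x [^] Suc k"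
  shows "finite (commutator_subgroup G N (carrier G))"
proof -
  interpret N: normal N G by (rule N)
  let ?S = "{commutator x y | x y. x \<in> N \<and> y \<in> carrier G}"
  have inN: "commutator x y \<in> N" if "x \<in> N" "y \<in> carrier G" for x y
  proof -
    have "commutator x y = x \<otimes> (y \<otimes> inv x \<otimes> inv y)" using that by (simp add: m_assoc)
    then show ?thesis using that N.inv_op_closed2 by simp
  qed
  have S: "?S \<subseteq> carrier G" by auto
  have memS: "commutator x y \<in> ?S" if "x \<in> N" "y \<in> carrier G" for x y using that by blast
  have conj: "g \<otimes> t \<otimes> inv g \<in> ?S" if g: "g \<in> carrier G" and t: "t \<in> ?S" for g t
  proof -
    obtain x y where xy: "x \<in> N" "y \<in> carrier G" "t = commutator x y" using t by blast
    then have "g \<otimes> t \<otimes> inv g = commutator (g \<otimes> x \<otimes> inv g) (g \<otimes> y \<otimes> inv g)"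
      using commutator_conj[of x y g] g by simp
    moreover have "g \<otimes> x \<otimes> inv g \<in> N" "g \<otimes> y \<otimes> inv g \<in> carrier G"
      using xy g N.inv_op_closed2 by simp_all
    ultimately show ?thesis by (simp only: memS)
  qed
  have invS: "inv t \<in> ?S" if t: "t \<in> ?S" for t
  proof -
    obtain x y where xy: "x \<in> N" "y \<in> carrier G" "t = commutator x y" using t by blast
    then have "inv t = commutator (inv x) (x \<otimes> y \<otimes> inv x)" using inv_commutator[of x y] by simp
    moreover have "inv x \<in> N" "x \<otimes> y \<otimes> inv x \<in> carrier G" using xy by simp_all
    ultimately show ?thesis by (simp only: memS)
  qed
  have "\<forall>s\<in>?S. \<exists>k. \<exists>zs. set zs \<subseteq> ?S \<and> length zs = k \<and> list_product zs = s [^] Suc k"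
  proof
    fix s assume "s \<in> ?S"
    then obtain x y where xy: "x \<in> N" "y \<in> carrier G" "s = commutator x y" by blast
    obtain k :: nat where k: "\<And>g. g \<in> carrier G \<Longrightarrow> s [^] Suc k \<otimes> g = g \<otimes> s [^] Suc k"
      using power[OF inN[OF xy(1,2)], folded xy(3)] by metis
    \<comment> \<open>the commutators in Rosenlicht's identity, whose left entry is still in \<open>N\<close>\<close>
    let ?x = "inv y \<otimes> x \<otimes> y"
    let ?zs = "replicate k (commutator ?x y) @ [commutator ?x (y \<otimes> y)]"
    have x: "?x \<in> N" using xy N.inv_op_closed1 by simp
    have "set (replicate k (commutator ?x y)) \<subseteq> carrier G" "set [commutator ?x (y \<otimes> y)] \<subseteq> carrier G"
      using xy by auto
    then have "list_product ?zs = list_product (replicate k (commutator ?x y)) \<otimes> commutator ?x (y \<otimes> y)"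
      using list_product_append[of "replicate k (commutator ?x y)" "[commutator ?x (y \<otimes> y)]"] xy by simp
    also have "list_product (replicate k (commutator ?x y)) = commutator ?x y [^] k"
      using xy by (intro list_product_replicate) simp
    also have "commutator ?x y [^] k \<otimes> commutator ?x (y \<otimes> y) = s [^] Suc (Suc k)"
      using commutator_power_shorten[OF _ xy(2) xy(3) k] xy(1) by simp
    finally have "list_product ?zs = s [^] Suc (Suc k)" .
    moreover have "set ?zs \<subseteq> ?S"
    proof -
      have "set ?zs \<subseteq> {commutator ?x y, commutator ?x (y \<otimes> y)}"
        by (auto simp: set_replicate_conv_if)
      also have "\<dots> \<subseteq> ?S"
        using memS[OF x xy(2)] memS[OF x m_closed[OF xy(2) xy(2)]] by (simp only: insert_subset empty_subsetI simp_thms)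
      finally show ?thesis .
    qed
    moreover have "length ?zs = Suc k" by simp
    ultimately show "\<exists>k. \<exists>zs. set zs \<subseteq> ?S \<and> length zs = k \<and> list_product zs = s [^] Suc k" by blast
  qed
  from bchoice[OF this] obtain m where
    m: "\<forall>s\<in>?S. \<exists>zs. set zs \<subseteq> ?S \<and> length zs = m s \<and> list_product zs = s [^] Suc (m s)" ..
  have "finite (generate G ?S)"
    by (rule finite_generate_if_powers_shorten[OF S conj invS fin bspec[OF m]])
  then show ?thesis unfolding commutator_subgroup_def .
qed

lemma commutator_subgroup_normal:
  assumes N: "N \<lhd> G"
  shows "commutator_subgroup G N (carrier G) \<lhd> G"
  unfolding commutator_subgroup_def
proof (rule normal_generateI)
  interpret N: normal N G by (rule N)
  show "{commutator x y |x y. x \<in> N \<and> y \<in> carrier G} \<subseteq> carrier G" by auto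
  fix h g assume "h \<in> {commutator x y |x y. x \<in> N \<and> y \<in> carrier G}" and g: "g \<in> carrier G"
  then obtain x y where xy: "x \<in> N" "y \<in> carrier G" "h = commutator x y" by blast
  then have "g \<otimes> h \<otimes> inv g = commutator (g \<otimes> x \<otimes> inv g) (g \<otimes> y \<otimes> inv g)"
    using commutator_conj[of x y g] g by simp
  moreover have "g \<otimes> x \<otimes> inv g \<in> N" "g \<otimes> y \<otimes> inv g \<in> carrier G"
    using xy g N.inv_op_closed2 by simp_all
  ultimately show "g \<otimes> h \<otimes> inv g \<in> {commutator x y |x y. x \<in> N \<and> y \<in> carrier G}"
    by (simp only:) blast
qed

section \<open>Baer's theorem for central chains\<close>

lemma commute_inv:
  assumes "x \<in> carrier G" "z \<in> carrier G" "z \<otimes> x = x \<otimes> z"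
  shows "z \<otimes> inv x = inv x \<otimes> z"
proof -
  have "z \<otimes> inv x = inv x \<otimes> (x \<otimes> z) \<otimes> inv x" using assms by (simp add: m_assoc cancel_inv_left)
  also have "\<dots> = inv x \<otimes> (z \<otimes> x) \<otimes> inv x" using assms(3) by simp
  also have "\<dots> = inv x \<otimes> z" using assms(1,2) by (simp add: m_assoc)
  finally show ?thesis .
qed

lemma commute_mult:
  assumes "x \<in> carrier G" "y \<in> carrier G" "z \<in> carrier G"
    and "z \<otimes> x = x \<otimes> z" "z \<otimes> y = y \<otimes> z"
  shows "z \<otimes> (x \<otimes> y) = (x \<otimes> y) \<otimes> z"
  using assms by (metis m_assoc)

text \<open>
  With \<open>u\<close> and \<open>v\<close> the two commutators in the hypotheses, \<open>zy = yzv\<close> and \<open>zg = gzu\<close>. As \<open>v\<close> is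
  central and \<open>u\<close> commutes with \<open>y\<close>, moving \<open>z\<close> past \<open>yg\<close> and past \<open>gy\<close> produces the same
  factor \<open>uv\<close>. This elementwise argument takes the place of the three subgroups lemma.
\<close>

lemma commute_commutator:
  assumes c: "z \<in> carrier G" "y \<in> carrier G" "g \<in> carrier G"
    and v: "\<And>h. h \<in> carrier G \<Longrightarrow>
      commutator (inv z) (inv y) \<otimes> h = h \<otimes> commutator (inv z) (inv y)"
    and u: "commutator (inv z) (inv g) \<otimes> y = y \<otimes> commutator (inv z) (inv g)"
  shows "z \<otimes> commutator y g = commutator y g \<otimes> z"
proof -
  define v where "v = commutator (inv z) (inv y)"
  define u where "u = commutator (inv z) (inv g)"
  have uv: "u \<in> carrier G" "v \<in> carrier G" using c by (auto simp: u_def v_def)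
  have vc: "v \<otimes> h = h \<otimes> v" if "h \<in> carrier G" for h using assms(4)[OF that] by (simp add: v_def)
  have zy: "z \<otimes> y = y \<otimes> (z \<otimes> v)" using c by (simp add: v_def m_assoc cancel_inv_left)
  have zg: "z \<otimes> g = g \<otimes> (z \<otimes> u)" using c by (simp add: u_def m_assoc cancel_inv_left)
  have uy: "u \<otimes> y = y \<otimes> u" using u by (simp add: u_def)
  have "z \<otimes> (y \<otimes> g) = y \<otimes> (z \<otimes> (v \<otimes> g))" using c uv zy by (metis m_assoc m_closed)
  also have "\<dots> = y \<otimes> ((z \<otimes> g) \<otimes> v)" using c uv vc[of g] by (simp add: m_assoc)
  also have "\<dots> = (y \<otimes> g) \<otimes> (z \<otimes> u \<otimes> v)" using c uv zg by (simp add: m_assoc)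
  finally have 1: "z \<otimes> (y \<otimes> g) = (y \<otimes> g) \<otimes> (z \<otimes> u \<otimes> v)" .
  have "z \<otimes> (g \<otimes> y) = g \<otimes> (z \<otimes> (u \<otimes> y))" using c uv zg by (metis m_assoc m_closed)
  also have "\<dots> = g \<otimes> ((z \<otimes> y) \<otimes> u)" using c uv uy by (simp add: m_assoc)
  also have "\<dots> = (g \<otimes> y) \<otimes> (z \<otimes> u \<otimes> v)" using c uv zy vc[of u] by (simp add: m_assoc)
  finally have 2: "z \<otimes> (g \<otimes> y) = (g \<otimes> y) \<otimes> (z \<otimes> u \<otimes> v)" .
  have "(z \<otimes> u \<otimes> v) \<otimes> inv (g \<otimes> y) =
      inv (g \<otimes> y) \<otimes> ((g \<otimes> y) \<otimes> (z \<otimes> u \<otimes> v)) \<otimes> inv (g \<otimes> y)"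
    using c uv cancel_inv_left(1)[of "g \<otimes> y" "z \<otimes> u \<otimes> v"] by simp
  also have "\<dots> = inv (g \<otimes> y) \<otimes> (z \<otimes> (g \<otimes> y)) \<otimes> inv (g \<otimes> y)" using 2 by simp
  also have "\<dots> = inv (g \<otimes> y) \<otimes> z"
    using c m_assoc[of "inv (g \<otimes> y)" "z \<otimes> (g \<otimes> y)" "inv (g \<otimes> y)"] m_assoc[of z "g \<otimes> y" "inv (g \<otimes> y)"]
    by simp
  finally have 3: "(z \<otimes> u \<otimes> v) \<otimes> inv (g \<otimes> y) = inv (g \<otimes> y) \<otimes> z" .
  have e: "commutator y g = (y \<otimes> g) \<otimes> inv (g \<otimes> y)" using c by (simp add: m_assoc inv_mult_group)
  have "z \<otimes> commutator y g = (z \<otimes> (y \<otimes> g)) \<otimes> inv (g \<otimes> y)" using c e by (simp add: m_assoc)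
  also have "\<dots> = (y \<otimes> g) \<otimes> ((z \<otimes> u \<otimes> v) \<otimes> inv (g \<otimes> y))" using c uv 1 by (simp add: m_assoc)
  also have "\<dots> = commutator y g \<otimes> z" unfolding 3 e using c by (simp add: m_assoc)
  finally show ?thesis .
qed

text \<open>
  Commutators of \<open>r\<close> and \<open>t\<close> depend only on the coset of \<open>r\<close> modulo central elements and on that of \<open>t\<close>
  modulo elements that commute with \<open>r\<close> and with \<open>t r\<^sup>-\<^sup>1 t\<^sup>-\<^sup>1\<close>. This is what leaves only finitely many
  commutators.
\<close>

lemma commutator_perturb:
  assumes c: "z \<in> carrier G" "r \<in> carrier G" "w \<in> carrier G" "t \<in> carrier G"
    and z: "\<And>h. h \<in> carrier G \<Longrightarrow> z \<otimes> h = h \<otimes> z"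
    and w: "w \<otimes> r = r \<otimes> w" "w \<otimes> (t \<otimes> inv r \<otimes> inv t) = (t \<otimes> inv r \<otimes> inv t) \<otimes> w"
  shows "commutator (z \<otimes> r) (w \<otimes> t) = commutator r t"
proof -
  let ?g = "w \<otimes> t"
  have "commutator (z \<otimes> r) ?g = z \<otimes> (r \<otimes> ?g \<otimes> inv r) \<otimes> inv z \<otimes> inv ?g"
    using c by (simp add: m_assoc inv_mult_group)
  also have "\<dots> = commutator r ?g" using c z[of "r \<otimes> ?g \<otimes> inv r"] by (simp add: m_assoc cancel_inv_left)
  also have "\<dots> = r \<otimes> w \<otimes> (t \<otimes> inv r \<otimes> inv t) \<otimes> inv w"
    using c by (simp add: m_assoc inv_mult_group)
  also have "\<dots> = r \<otimes> (w \<otimes> (t \<otimes> inv r \<otimes> inv t)) \<otimes> inv w" using c by (simp add: m_assoc)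
  also have "\<dots> = commutator r t" unfolding w(2) using c by (simp add: m_assoc)
  finally show ?thesis .
qed

lemma coset_commute_iff:
  assumes H: "subgroup H G" and c: "x \<in> carrier G" "y \<in> carrier G"
  shows "H #> (x \<otimes> y) = H #> (y \<otimes> x) \<longleftrightarrow> commutator x y \<in> H"
proof -
  have e: "x \<otimes> y = commutator x y \<otimes> (y \<otimes> x)" using c by (simp add: m_assoc cancel_inv_left)
  have e': "commutator x y = (x \<otimes> y) \<otimes> inv (y \<otimes> x)" using c by (simp add: m_assoc inv_mult_group)
  show ?thesis
  proof
    assume "H #> (x \<otimes> y) = H #> (y \<otimes> x)"
    then have "x \<otimes> y \<in> H #> (y \<otimes> x)" using rcos_self[OF _ H, of "x \<otimes> y"] c by simp
    then obtain h where h: "h \<in> H" "x \<otimes> y = h \<otimes> (y \<otimes> x)" by (auto simp: r_coset_def)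
    then have "commutator x y = h"
      unfolding e' h(2) using c subgroup.mem_carrier[OF H h(1)] by (simp add: m_assoc)
    then show "commutator x y \<in> H" using h by simp
  next
    assume "commutator x y \<in> H"
    then have "x \<otimes> y \<in> H #> (y \<otimes> x)" using e by (auto simp: r_coset_def)
    then show "H #> (x \<otimes> y) = H #> (y \<otimes> x)" using repr_independence[OF _ _ H] c by simp
  qed
qed

text \<open>
  Two of the powers of \<open>x\<close> lie in the same coset, so their quotient lies in \<open>H\<close>.
\<close>

lemma power_in_finite_index:
  assumes H: "subgroup H G" and N: "subgroup N G" and x: "x \<in> N"
    and fin: "finite ((\<lambda>x. H #> x) ` N)"
  shows "\<exists>k::nat. x [^] Suc k \<in> H"
proof -
  have xc: "x \<in> carrier G" using subgroup.mem_carrier[OF N x] .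
  have "x [^] i \<in> N" for i :: nat
    by (induction i) (simp_all add: subgroup.one_closed[OF N] subgroup.m_closed[OF N] x)
  then have "range (\<lambda>i::nat. H #> x [^] i) \<subseteq> (\<lambda>x. H #> x) ` N" by blast
  then have "\<not> inj (\<lambda>i::nat. H #> x [^] i)"
    using fin finite_subset finite_imageD infinite_UNIV_nat by metis
  then obtain a b :: nat where ab: "H #> x [^] a = H #> x [^] b" "a < b"
    by (metis (mono_tags, lifting) injI linorder_neqE_nat)
  obtain k where k: "b = Suc k + a" using ab(2) less_iff_Suc_add by (metis add.commute add_Suc)
  have "x [^] b \<in> H #> x [^] a" using ab(1) rcos_self[OF _ H, of "x [^] b"] xc by simp
  then obtain h where h: "h \<in> H" "x [^] b = h \<otimes> x [^] a" by (auto simp: r_coset_def)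
  have "x [^] b = x [^] Suc k \<otimes> x [^] a" using xc k by (simp only: nat_pow_mult)
  then have "x [^] Suc k = h"
    using h xc subgroup.mem_carrier[OF H h(1)] by (metis nat_pow_closed right_cancel)
  then show ?thesis using h(1) by blast
qed

text \<open>
  The lower central series indexed from 0: the term at \<open>k\<close> is usually called \<open>\<gamma>\<^sub>k\<^sub>+\<^sub>1(G)\<close>.
\<close>

primrec commutator_series :: "nat \<Rightarrow> 'a set"
  where
    "commutator_series 0 = carrier G"
  | "commutator_series (Suc k) = commutator_subgroup G (commutator_series k) (carrier G)"

lemma commutator_series_normal: "commutator_series k \<lhd> G"
proof (induction k)
  case 0
  show ?case by (simp add: normal_inv_iff subgroup_self)
next
  case (Suc k)
  then show ?case using commutator_subgroup_normal by simp
qed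

end

locale central_chain = group +
  fixes Z :: "nat \<Rightarrow> 'a set"
  assumes Z_subgroup: "subgroup (Z i) G"
    and Z_mono: "Z i \<subseteq> Z (Suc i)"
    and Z_central: "z \<in> Z (Suc i) \<Longrightarrow> g \<in> carrier G \<Longrightarrow> commutator z g \<in> Z i"
begin

lemma Z_carrier: "z \<in> Z i \<Longrightarrow> z \<in> carrier G"
  by (rule subgroup.mem_carrier[OF Z_subgroup])

lemma Z_normal: "Z i \<lhd> G"
proof (rule normal_invI[OF Z_subgroup])
  fix g z assume g: "g \<in> carrier G" and z: "z \<in> Z i"
  have "commutator z g \<in> Z i" using Z_central[of z i g] z g Z_mono by blast
  then have "inv (commutator z g) \<otimes> z \<in> Z i"
    using subgroup.m_closed[OF Z_subgroup] subgroup.m_inv_closed[OF Z_subgroup] z by simp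
  moreover have "inv (commutator z g) \<otimes> z = g \<otimes> z \<otimes> inv g"
    using g Z_carrier[OF z] by (simp add: inv_mult_group m_assoc cancel_inv_left)
  ultimately show "g \<otimes> z \<otimes> inv g \<in> Z i" by simp
qed

lemma coset_hom: "group_hom G (G Mod Z j) (\<lambda>x. Z j #> x)"
  using normal.factorgroup_is_group[OF Z_normal] normal.r_coset_hom_Mod[OF Z_normal] is_group
  by (intro group_hom.intro group_hom_axioms.intro)

text \<open>
  The classical inclusion \<open>[\<gamma>\<^sub>k\<^sub>+\<^sub>1(G), Z\<^sub>j\<^sub>+\<^sub>k\<^sub>+\<^sub>1] \<subseteq> Z\<^sub>j\<close>. Modulo \<open>Z\<^sub>j\<close> the elements that commute with \<open>z\<close>
  form a subgroup, and for a generator \<open>[y,g]\<close> with \<open>y \<in> \<gamma>\<^sub>k\<^sub>+\<^sub>1(G)\<close> the hypotheses of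
  \<open>commute_commutator\<close> follow by induction (up to inverses of the entries): \<open>[z,y]\<close> lies in \<open>Z\<^sub>j\<^sub>+\<^sub>1\<close>, and \<open>[z,g]\<close> is one term further down
  the chain than \<open>z\<close>.
\<close>

lemma commutator_series_commutes:
  "x \<in> commutator_series k \<Longrightarrow> z \<in> Z (Suc (j + k)) \<Longrightarrow> commutator z x \<in> Z j"
proof (induction k arbitrary: j x z)
  case 0
  then show ?case using Z_central by simp
next
  case (Suc k)
  interpret h: group_hom G "G Mod Z j" "\<lambda>x. Z j #> x" by (rule coset_hom)
  have sub: "subgroup (commutator_series k) G"
    by (rule normal_imp_subgroup[OF commutator_series_normal])
  let ?p = "\<lambda>x. Z j #> x"
  let ?Q = "G Mod Z j"
  have zc: "z \<in> carrier G" using Z_carrier Suc.prems by blast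
  have com: "commutator a b \<in> Z j \<longleftrightarrow> ?p a \<otimes>\<^bsub>?Q\<^esub> ?p b = ?p b \<otimes>\<^bsub>?Q\<^esub> ?p a"
    if "a \<in> carrier G" "b \<in> carrier G" for a b
    unfolding h.hom_mult[OF that, symmetric] h.hom_mult[OF that(2,1), symmetric]
    using coset_commute_iff[OF Z_subgroup that] by simp
  have gen: "?p z \<otimes>\<^bsub>?Q\<^esub> ?p (commutator y g) = ?p (commutator y g) \<otimes>\<^bsub>?Q\<^esub> ?p z"
    if y: "y \<in> commutator_series k" and g: "g \<in> carrier G" for y g
  proof -
    have yc: "y \<in> carrier G" "inv y \<in> commutator_series k"
      using subgroup.mem_carrier[OF sub y] subgroup.m_inv_closed[OF sub y] by simp_all
    have zi: "inv z \<in> Z (Suc (Suc j + k))"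
      using Suc.prems subgroup.m_inv_closed[OF Z_subgroup] by simp
    let ?v = "commutator (inv z) (inv y)" and ?u = "commutator (inv z) (inv g)"
    have v: "?v \<in> Z (Suc j)" using Suc.IH[OF yc(2) zi] .
    have u: "?u \<in> Z (Suc (j + k))" using Z_central[of "inv z" "Suc (j + k)" "inv g"] zi g by simp
    have vQ: "?p ?v \<otimes>\<^bsub>?Q\<^esub> X = X \<otimes>\<^bsub>?Q\<^esub> ?p ?v" if X: "X \<in> carrier ?Q" for X
    proof -
      obtain h where "h \<in> carrier G" "X = ?p h" using X by (auto simp: FactGroup_def RCOSETS_def)
      then show ?thesis using com[of ?v h] Z_central[OF v] Z_carrier[OF v] by simp
    qed
    have uQ: "?p ?u \<otimes>\<^bsub>?Q\<^esub> ?p y = ?p y \<otimes>\<^bsub>?Q\<^esub> ?p ?u"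
      using com[of ?u y] Suc.IH[OF y u] Z_carrier[OF u] yc by simp
    have pc: "?p (commutator a b) = h.H.commutator (?p a) (?p b)"
      if "a \<in> carrier G" "b \<in> carrier G" for a b
      using that by (simp only: h.hom_mult h.hom_inv m_closed inv_closed)
    show ?thesis
      unfolding pc[OF yc(1) g]
    proof (rule h.H.commute_commutator)
      show "h.H.commutator (inv\<^bsub>?Q\<^esub> ?p z) (inv\<^bsub>?Q\<^esub> ?p y) \<otimes>\<^bsub>?Q\<^esub> X
          = X \<otimes>\<^bsub>?Q\<^esub> h.H.commutator (inv\<^bsub>?Q\<^esub> ?p z) (inv\<^bsub>?Q\<^esub> ?p y)" if "X \<in> carrier ?Q" for X
        using vQ[OF that] pc[of "inv z" "inv y"] zc yc by (simp only: h.hom_inv inv_closed)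
      show "h.H.commutator (inv\<^bsub>?Q\<^esub> ?p z) (inv\<^bsub>?Q\<^esub> ?p g) \<otimes>\<^bsub>?Q\<^esub> ?p y
          = ?p y \<otimes>\<^bsub>?Q\<^esub> h.H.commutator (inv\<^bsub>?Q\<^esub> ?p z) (inv\<^bsub>?Q\<^esub> ?p g)"
        using uQ pc[of "inv z" "inv g"] zc g by (simp only: h.hom_inv inv_closed)
    qed (use zc yc g h.hom_closed in auto)
  qed
  have S: "{commutator x y |x y. x \<in> commutator_series k \<and> y \<in> carrier G} \<subseteq> carrier G"
    using subgroup.mem_carrier[OF sub] by auto
  have "x \<in> generate G {commutator x y |x y. x \<in> commutator_series k \<and> y \<in> carrier G}"
    using Suc.prems(1) by (simp add: commutator_subgroup_def)
  then have "?p z \<otimes>\<^bsub>?Q\<^esub> ?p x = ?p x \<otimes>\<^bsub>?Q\<^esub> ?p z"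
  proof (induction rule: generate.induct)
    case one
    show ?case by (simp only: h.hom_one h.H.l_one h.H.r_one h.hom_closed zc)
  next
    case (incl h)
    then show ?case using gen by blast
  next
    case (inv h)
    then have "?p z \<otimes>\<^bsub>?Q\<^esub> ?p h = ?p h \<otimes>\<^bsub>?Q\<^esub> ?p z" using gen by blast
    moreover have "h \<in> carrier G" using inv S by blast
    ultimately show ?case using h.H.commute_inv[of "?p h" "?p z"] zc by simp
  next
    case (eng h1 h2)
    have "h1 \<in> carrier G" "h2 \<in> carrier G" using eng(1,2) generate_in_carrier[OF S] by blast+
    then show ?case using h.H.commute_mult[of "?p h1" "?p h2" "?p z"] eng(3,4) zc by simp
  qed
  moreover have "x \<in> carrier G"
    by (rule subgroup.mem_carrier[OF normal_imp_subgroup[OF commutator_series_normal] Suc.prems(1)])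
  ultimately show ?case using com[OF zc] by blast
qed

text \<open>
  The step from \<open>\<gamma>\<^sub>k\<^sub>+\<^sub>1(G)\<close> to \<open>\<gamma>\<^sub>k\<^sub>+\<^sub>2(G)\<close>, carried out in \<open>G/Z\<^sub>j\<close>. There \<open>Z\<^sub>j\<^sub>+\<^sub>1\<close> is central and
  \<open>Z\<^sub>j\<^sub>+\<^sub>k\<^sub>+\<^sub>1\<close> centralises the image of \<open>\<gamma>\<^sub>k\<^sub>+\<^sub>1(G)\<close>. Hence representatives of the cosets of
  \<open>Z\<^sub>j\<^sub>+\<^sub>1\<close> in \<open>\<gamma>\<^sub>k\<^sub>+\<^sub>1(G)\<close> and of \<open>Z\<^sub>j\<^sub>+\<^sub>k\<^sub>+\<^sub>1\<close> in \<open>G\<close> already give all commutators.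
\<close>

lemma finite_modulo_step:
  assumes fin_index: "finite ((\<lambda>x. Z (Suc (j + k)) #> x) ` carrier G)"
    and fin: "finite ((\<lambda>x. Z (Suc j) #> x) ` commutator_series k)"
  shows "finite ((\<lambda>x. Z j #> x) ` commutator_series (Suc k))"
proof -
  interpret h: group_hom G "G Mod Z j" "\<lambda>x. Z j #> x" by (rule coset_hom)
  let ?p = "\<lambda>x. Z j #> x"
  let ?Q = "G Mod Z j"
  let ?L = "commutator_series k"
  interpret L: normal ?L G by (rule commutator_series_normal)
  have carr: "carrier ?Q = ?p ` carrier G" by (auto simp: FactGroup_def RCOSETS_def)
  have com: "?p a \<otimes>\<^bsub>?Q\<^esub> ?p b = ?p b \<otimes>\<^bsub>?Q\<^esub> ?p a"
    if "a \<in> carrier G" "b \<in> carrier G" "commutator a b \<in> Z j" for a b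
    unfolding h.hom_mult[OF that(1,2), symmetric] h.hom_mult[OF that(2,1), symmetric]
    using coset_commute_iff[OF Z_subgroup that(1,2)] that(3) by simp
  have pc: "?p (commutator a b) = h.H.commutator (?p a) (?p b)"
    if "a \<in> carrier G" "b \<in> carrier G" for a b
    using that by (simp only: h.hom_mult h.hom_inv m_closed inv_closed)
  have normal: "?p ` ?L \<lhd> ?Q"
    by (rule L.surj_hom_normal_subgroup[OF h.group_hom_axioms carr[symmetric]])
  let ?S = "{commutator x y |x y. x \<in> ?L \<and> y \<in> carrier G}"
  let ?T = "{h.H.commutator X Y |X Y. X \<in> ?p ` ?L \<and> Y \<in> carrier ?Q}"
  have TS: "?T = ?p ` ?S"
  proof (intro equalityI subsetI)
    fix X assume "X \<in> ?T"
    then obtain x y where xy: "x \<in> ?L" "y \<in> carrier G" "X = h.H.commutator (?p x) (?p y)"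
      unfolding carr by blast
    then have "X = ?p (commutator x y)" using pc[OF L.mem_carrier] by metis
    then show "X \<in> ?p ` ?S" using xy by blast
  next
    fix X assume "X \<in> ?p ` ?S"
    then obtain x y where xy: "x \<in> ?L" "y \<in> carrier G" "X = ?p (commutator x y)" by blast
    then have "X = h.H.commutator (?p x) (?p y)" using pc[OF L.mem_carrier] by metis
    then show "X \<in> ?T" unfolding carr using xy by blast
  qed
  obtain R where R: "R \<subseteq> ?L" "finite R" "(\<lambda>x. Z (Suc j) #> x) ` ?L = (\<lambda>x. Z (Suc j) #> x) ` R"
    using finite_subset_image[OF fin subset_refl] by metis
  obtain T where T: "T \<subseteq> carrier G" "finite T"
    "(\<lambda>x. Z (Suc (j + k)) #> x) ` carrier G = (\<lambda>x. Z (Suc (j + k)) #> x) ` T"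
    using finite_subset_image[OF fin_index subset_refl] by metis
  have "?T \<subseteq> (\<lambda>(r, t). h.H.commutator (?p r) (?p t)) ` (R \<times> T)"
  proof
    fix X assume "X \<in> ?T"
    then obtain x g where xg: "x \<in> ?L" "g \<in> carrier G" "X = h.H.commutator (?p x) (?p g)"
      unfolding carr by blast
    have "x \<in> carrier G" using xg by simp
    have "Z (Suc j) #> x \<in> (\<lambda>x. Z (Suc j) #> x) ` R" using R(3) xg(1) by blast
    then obtain r where r: "r \<in> R" "Z (Suc j) #> x = Z (Suc j) #> r" by blast
    then have "x \<in> Z (Suc j) #> r" using rcos_self[OF \<open>x \<in> carrier G\<close> Z_subgroup, of "Suc j"] by simp
    then obtain z where z: "z \<in> Z (Suc j)" "x = z \<otimes> r" by (auto simp: r_coset_def)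
    have "Z (Suc (j + k)) #> g \<in> (\<lambda>x. Z (Suc (j + k)) #> x) ` T" using T(3) xg(2) by blast
    then obtain t where t: "t \<in> T" "Z (Suc (j + k)) #> g = Z (Suc (j + k)) #> t" by blast
    then have "g \<in> Z (Suc (j + k)) #> t" using rcos_self[OF xg(2) Z_subgroup, of "Suc (j + k)"] by simp
    then obtain w where w: "w \<in> Z (Suc (j + k))" "g = w \<otimes> t" by (auto simp: r_coset_def)
    have rL: "r \<in> ?L" and tc: "t \<in> carrier G" using r R t T by auto
    have c: "z \<in> carrier G" "r \<in> carrier G" "w \<in> carrier G"
      using Z_carrier z w rL by auto
    have inL: "t \<otimes> inv r \<otimes> inv t \<in> ?L" using rL tc L.inv_op_closed2 by simp
    have "h.H.commutator (?p z \<otimes>\<^bsub>?Q\<^esub> ?p r) (?p w \<otimes>\<^bsub>?Q\<^esub> ?p t) = h.H.commutator (?p r) (?p t)"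
    proof (rule h.H.commutator_perturb)
      show "?p z \<otimes>\<^bsub>?Q\<^esub> X = X \<otimes>\<^bsub>?Q\<^esub> ?p z" if "X \<in> carrier ?Q" for X
        using that com[OF c(1)] Z_central[OF z(1)] unfolding carr by blast
      show "?p w \<otimes>\<^bsub>?Q\<^esub> ?p r = ?p r \<otimes>\<^bsub>?Q\<^esub> ?p w"
        using com[OF c(3) c(2)] commutator_series_commutes[OF rL w(1)] by blast
      have "?p (t \<otimes> inv r \<otimes> inv t) = ?p t \<otimes>\<^bsub>?Q\<^esub> inv\<^bsub>?Q\<^esub> ?p r \<otimes>\<^bsub>?Q\<^esub> inv\<^bsub>?Q\<^esub> ?p t"
        using c tc by (simp only: h.hom_mult h.hom_inv m_closed inv_closed)
      then show "?p w \<otimes>\<^bsub>?Q\<^esub> (?p t \<otimes>\<^bsub>?Q\<^esub> inv\<^bsub>?Q\<^esub> ?p r \<otimes>\<^bsub>?Q\<^esub> inv\<^bsub>?Q\<^esub> ?p t) =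
        (?p t \<otimes>\<^bsub>?Q\<^esub> inv\<^bsub>?Q\<^esub> ?p r \<otimes>\<^bsub>?Q\<^esub> inv\<^bsub>?Q\<^esub> ?p t) \<otimes>\<^bsub>?Q\<^esub> ?p w"
        using com[OF c(3) L.mem_carrier[OF inL] commutator_series_commutes[OF inL w(1)]] by simp
    qed (use c tc h.hom_closed in auto)
    then have "X = h.H.commutator (?p r) (?p t)"
      unfolding xg(3) z(2) w(2) using c tc by (simp only: h.hom_mult)
    then show "X \<in> (\<lambda>(r, t). h.H.commutator (?p r) (?p t)) ` (R \<times> T)" using r t by blast
  qed
  then have finT: "finite ?T" using R(2) T(2) by (meson finite_SigmaI finite_surj)
  have "finite (commutator_subgroup ?Q (?p ` ?L) (carrier ?Q))"
  proof (rule h.H.finite_commutator_subgroup[OF normal finT])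
    fix X assume "X \<in> ?p ` ?L"
    then obtain x where x: "x \<in> ?L" "X = ?p x" by blast
    obtain i :: nat where i: "x [^] Suc i \<in> Z (Suc j)"
      using power_in_finite_index[OF Z_subgroup L.subgroup_axioms x(1) fin] by blast
    have "X [^]\<^bsub>?Q\<^esub> Suc i = ?p (x [^] Suc i)"
      using h.hom_nat_pow[of x "Suc i"] x by (simp del: nat_pow_Suc)
    then have "X [^]\<^bsub>?Q\<^esub> Suc i \<otimes>\<^bsub>?Q\<^esub> Y = Y \<otimes>\<^bsub>?Q\<^esub> X [^]\<^bsub>?Q\<^esub> Suc i" if "Y \<in> carrier ?Q" for Y
      using that com[OF Z_carrier[OF i]] Z_central[OF i] unfolding carr by force
    then show "\<exists>i::nat. \<forall>Y\<in>carrier ?Q. X [^]\<^bsub>?Q\<^esub> Suc i \<otimes>\<^bsub>?Q\<^esub> Y = Y \<otimes>\<^bsub>?Q\<^esub> X [^]\<^bsub>?Q\<^esub> Suc i" by blast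
  qed
  moreover have "?S \<subseteq> carrier G" by auto
  ultimately show ?thesis
    unfolding commutator_subgroup_def commutator_series.simps TS by (simp only: h.generate_img)
qed

text \<open>
  Baer's theorem. From \<open>k\<close> to \<open>k + 1\<close> the finiteness modulus drops from \<open>Z\<^sub>n\<^sub>-\<^sub>k\<close> to \<open>Z\<^sub>n\<^sub>-\<^sub>k\<^sub>-\<^sub>1\<close>, and at
  \<open>k = n\<close> the modulus \<open>Z\<^sub>0\<close> is trivial.
\<close>

theorem finite_commutator_series:
  assumes fin: "finite ((\<lambda>x. Z n #> x) ` carrier G)" and Z0: "Z 0 = {\<one>}"
  shows "finite (commutator_series n)"
proof -
  have step: "finite ((\<lambda>x. Z (n - k) #> x) ` commutator_series k)" if "k \<le> n" for k
    using that
  proof (induction k)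
    case 0
    then show ?case using fin by simp
  next
    case (Suc k)
    then have "n - k = Suc (n - Suc k)" "n = Suc ((n - Suc k) + k)" by simp_all
    then show ?case using finite_modulo_step[of "n - Suc k" k] Suc fin by simp
  qed
  have "finite ((\<lambda>x. {\<one>} #> x) ` commutator_series n)" using step[of n] Z0 by simp
  moreover have "inj_on (\<lambda>x. {\<one>} #> x) (commutator_series n)"
  proof (rule inj_onI)
    fix x y assume xy: "x \<in> commutator_series n" "y \<in> commutator_series n" "{\<one>} #> x = {\<one>} #> y"
    then have "x \<in> carrier G" "y \<in> carrier G"
      using subgroup.mem_carrier[OF normal_imp_subgroup[OF commutator_series_normal[of n]]] by blast+
    then show "x = y" using xy(3) by (simp add: r_coset_def)
  qed
  ultimately show ?thesis by (rule finite_imageD)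
qed

end

section \<open>Skew braces and their ideals\<close>

sublocale skew_brace \<subseteq> add: group "add_monoid B"
  rewrites "carrier (add_monoid B) = carrier B"
    and "monoid.mult (add_monoid B) = add B"
    and "one (add_monoid B) = zero B"
    and "m_inv (add_monoid B) = a_inv B"
  by (rule add_group) (simp_all add: a_inv_def)

sublocale skew_brace \<subseteq> M: group B
  by (rule mult_group)

context skew_brace
begin

abbreviation lam :: "'a \<Rightarrow> 'a \<Rightarrow> 'a"
  where "lam \<equiv> brace_lambda B"

lemma one_zero [simp]: "\<one> = \<zero>"
  by (simp add: zero_eq_one)

lemmas mult_zero [simp] = M.l_one[unfolded one_zero] M.r_one[unfolded one_zero]
  M.l_inv[unfolded one_zero] M.r_inv[unfolded one_zero]

lemma lam_closed [simp]: "a \<in> carrier B \<Longrightarrow> b \<in> carrier B \<Longrightarrow> lam a b \<in> carrier B"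
  by (simp add: brace_lambda_def)

lemma mult_lam: "a \<in> carrier B \<Longrightarrow> b \<in> carrier B \<Longrightarrow> a \<otimes> b = a \<oplus> lam a b"
  by (simp add: brace_lambda_def add.cancel_inv_left)

lemma star_lam: "brace_star B a b = lam a b \<oplus> \<ominus> b"
  by (simp add: brace_star_def brace_lambda_def a_minus_def)

lemma lam_add:
  assumes "a \<in> carrier B" "b \<in> carrier B" "c \<in> carrier B"
  shows "lam a (b \<oplus> c) = lam a b \<oplus> lam a c"
  using assms compat[OF assms] by (simp add: brace_lambda_def a_minus_def add.m_assoc)

lemma lam_mult:
  assumes "a \<in> carrier B" "b \<in> carrier B" "c \<in> carrier B"
  shows "lam (a \<otimes> b) c = lam a (lam b c)"
proof -
  have "(a \<otimes> b) \<oplus> lam (a \<otimes> b) c = a \<otimes> (b \<otimes> c)"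
    using assms by (simp add: mult_lam[symmetric] M.m_assoc)
  also have "\<dots> = a \<oplus> lam a (b \<oplus> lam b c)" using assms mult_lam by simp
  also have "\<dots> = (a \<otimes> b) \<oplus> lam a (lam b c)"
    using assms by (simp add: lam_add mult_lam[of a b] add.m_assoc)
  finally show ?thesis using assms by simp
qed

lemma lam_zero [simp]:
  assumes "a \<in> carrier B"
  shows "lam \<zero> a = a" "lam a \<zero> = \<zero>"
  using assms by (simp_all add: brace_lambda_def)

lemma lam_inv [simp]:
  assumes "a \<in> carrier B" "b \<in> carrier B"
  shows "lam a (lam (inv a) b) = b" "lam (inv a) (lam a b) = b"
  using assms by (simp_all add: lam_mult[symmetric])

lemma lam_neg:
  assumes "a \<in> carrier B" "b \<in> carrier B"
  shows "lam a (\<ominus> b) = \<ominus> lam a b"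
proof -
  have "lam a (\<ominus> b) \<oplus> lam a b = \<zero>" using assms by (simp add: lam_add[symmetric])
  then show ?thesis using assms add.inv_equality by simp
qed

lemma inv_lam:
  assumes "a \<in> carrier B"
  shows "inv a = lam (inv a) (\<ominus> a)"
proof -
  have "a \<oplus> lam a (inv a) = \<zero>" using assms by (simp add: mult_lam[symmetric])
  then have "lam a (inv a) = \<ominus> a"
    using assms add.cancel_inv_left(1)[of a "lam a (inv a)"] by simp
  then show ?thesis using assms lam_inv(2)[of a "inv a"] by simp
qed

text \<open>
  A normal subgroup of \<open>(B,+)\<close> that is stable under \<open>\<lambda>\<close> is automatically a subgroup of \<open>(B,\<cdot>)\<close>,
  because \<open>ab = a + \<lambda>\<^sub>a(b)\<close>, and \<open>c = a\<^sup>-\<^sup>1\<close> satisfies \<open>c = \<lambda>\<^sub>c(-a)\<close>. It also absorbs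
  \<open>b * i = \<lambda>\<^sub>b(i) - i\<close>, so that only the elements \<open>i * b\<close> remain to be controlled.
\<close>

lemma brace_idealI:
  assumes N: "I \<lhd> add_monoid B"
    and lam: "\<And>b i. b \<in> carrier B \<Longrightarrow> i \<in> I \<Longrightarrow> lam b i \<in> I"
    and star: "\<And>b i. b \<in> carrier B \<Longrightarrow> i \<in> I \<Longrightarrow> lam i b \<oplus> \<ominus> b \<in> I"
  shows "brace_ideal I B"
proof -
  have sub: "subgroup I (add_monoid B)" using N by (rule normal_imp_subgroup)
  have c: "i \<in> carrier B" if "i \<in> I" for i using subgroup.mem_carrier[OF sub that] by simp
  have neg: "\<ominus> i \<in> I" if "i \<in> I" for i
    using subgroup.m_inv_closed[OF sub that] by (simp add: a_inv_def)
  have plus: "i \<oplus> j \<in> I" if "i \<in> I" "j \<in> I" for i j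
    using subgroup.m_closed[OF sub that] by simp
  have "subgroup I B"
  proof (rule M.subgroupI)
    show "I \<subseteq> carrier B" using c by blast
    show "I \<noteq> {}" using subgroup.one_closed[OF sub] by blast
    show "inv a \<in> I" if "a \<in> I" for a
      by (subst inv_lam) (use that c neg lam in auto)
    show "a \<otimes> b \<in> I" if "a \<in> I" "b \<in> I" for a b
      using that c plus lam by (simp add: mult_lam)
  qed
  moreover have "star_set B (carrier B) I \<subseteq> I" "star_set B I (carrier B) \<subseteq> I"
    unfolding star_set_def
    by (rule add.generate_subgroup_incl[OF _ sub]; use c star lam neg plus in \<open>auto simp: star_lam\<close>)+
  ultimately show ?thesis using N sub by (simp add: brace_ideal_def subbrace_def)
qed

lemma brace_ideal_carrier: "brace_ideal (carrier B) B"
proof (rule brace_idealI)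
  show "carrier B \<lhd> add_monoid B"
    using add.normal_inv_iff[of "carrier B"] add.subgroup_self by simp
qed simp_all

lemma brace_ideal_zero: "brace_ideal {\<zero>} B"
  using add.one_is_normal by (intro brace_idealI) auto

end

locale skew_brace_ideal = skew_brace +
  fixes I
  assumes ideal: "brace_ideal I B"
begin

lemma I_normal: "I \<lhd> add_monoid B" and I_add_subgroup: "subgroup I (add_monoid B)"
  and I_mult_subgroup: "subgroup I B"
  using ideal by (auto simp: brace_ideal_def subbrace_def)

lemma I_carrier [simp]: "i \<in> I \<Longrightarrow> i \<in> carrier B"
  using subgroup.mem_carrier[OF I_mult_subgroup] .

lemma I_zero [simp]: "\<zero> \<in> I"
  using subgroup.one_closed[OF I_add_subgroup] by simp

lemma I_plus [simp]: "i \<in> I \<Longrightarrow> j \<in> I \<Longrightarrow> i \<oplus> j \<in> I"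
  using subgroup.m_closed[OF I_add_subgroup] by simp

lemma I_neg [simp]: "i \<in> I \<Longrightarrow> \<ominus> i \<in> I"
  using subgroup.m_inv_closed[OF I_add_subgroup] by (simp add: a_inv_def)

lemma I_conj: "i \<in> I \<Longrightarrow> b \<in> carrier B \<Longrightarrow> b \<oplus> i \<oplus> \<ominus> b \<in> I"
  using normal.inv_op_closed2[OF I_normal, of b i] by (simp add: a_inv_def)

lemma I_star: "i \<in> I \<Longrightarrow> b \<in> carrier B \<Longrightarrow> lam i b \<oplus> \<ominus> b \<in> I"
proof -
  assume a: "i \<in> I" "b \<in> carrier B"
  then have "brace_star B i b \<in> star_set B I (carrier B)"
    unfolding star_set_def by (intro generate.incl) blast
  then show ?thesis using ideal unfolding brace_ideal_def star_lam by blast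
qed

lemma I_lam: "i \<in> I \<Longrightarrow> b \<in> carrier B \<Longrightarrow> lam b i \<in> I"
proof -
  assume a: "i \<in> I" "b \<in> carrier B"
  then have "brace_star B b i \<in> star_set B (carrier B) I"
    unfolding star_set_def by (intro generate.incl) blast
  then have "lam b i \<oplus> \<ominus> i \<in> I" using ideal unfolding brace_ideal_def star_lam by blast
  then have "(lam b i \<oplus> \<ominus> i) \<oplus> i \<in> I" using a by simp
  then show ?thesis using a by (simp add: add.m_assoc)
qed

text \<open>
  Calculations in \<open>B/I\<close> are done with representatives: \<open>congr\<close> is equality of the cosets of \<open>I\<close>, and it
  is compatible with addition, multiplication and \<open>\<lambda>\<close> in both arguments.
\<close>

definition congr :: "'a \<Rightarrow> 'a \<Rightarrow> bool"
  where "congr x y \<longleftrightarrow> x \<in> carrier B \<and> y \<in> carrier B \<and> x \<oplus> \<ominus> y \<in> I"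

lemma congr_carrier: "congr x y \<Longrightarrow> x \<in> carrier B" "congr x y \<Longrightarrow> y \<in> carrier B"
  by (simp_all add: congr_def)

lemma congr_refl [simp]: "x \<in> carrier B \<Longrightarrow> congr x x"
  by (simp add: congr_def)

lemma congr_sym: "congr x y \<Longrightarrow> congr y x"
proof -
  assume c: "congr x y"
  then have "\<ominus> (x \<oplus> \<ominus> y) \<in> I" by (simp add: congr_def)
  then show ?thesis using c by (simp add: congr_def add.inv_mult_group)
qed

lemma congr_trans [trans]: "congr x y \<Longrightarrow> congr y z \<Longrightarrow> congr x z"
proof -
  assume c: "congr x y" "congr y z"
  then have "(x \<oplus> \<ominus> y) \<oplus> (y \<oplus> \<ominus> z) \<in> I" by (simp add: congr_def)
  then show ?thesis using c by (simp add: congr_def add.m_assoc add.cancel_inv_left)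
qed

lemma congr_zero_iff: "congr x \<zero> \<longleftrightarrow> x \<in> I"
  by (auto simp: congr_def)

lemma congr_add:
  assumes c: "congr x x'" "congr y y'"
  shows "congr (x \<oplus> y) (x' \<oplus> y')"
proof -
  \<comment> \<open>this element is \<open>(x + y) - (x' + y')\<close>\<close>
  have "(x \<oplus> (y \<oplus> \<ominus> y') \<oplus> \<ominus> x) \<oplus> (x \<oplus> \<ominus> x') \<in> I"
    using c I_plus[OF I_conj, of "y \<oplus> \<ominus> y'" x "x \<oplus> \<ominus> x'"] by (simp add: congr_def)
  then show ?thesis
    using c by (simp add: congr_def add.m_assoc add.cancel_inv_left add.inv_mult_group)
qed

lemma congr_add_left: "congr x y \<Longrightarrow> b \<in> carrier B \<Longrightarrow> congr (b \<oplus> x) (b \<oplus> y)"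
  and congr_add_right: "congr x y \<Longrightarrow> b \<in> carrier B \<Longrightarrow> congr (x \<oplus> b) (y \<oplus> b)"
  by (simp_all add: congr_add)

lemma congr_neg:
  assumes "congr x y"
  shows "congr (\<ominus> x) (\<ominus> y)"
proof -
  note c = congr_carrier[OF assms]
  have "congr (\<ominus> x \<oplus> (x \<oplus> \<ominus> y)) (\<ominus> x \<oplus> (y \<oplus> \<ominus> y))"
    using assms c by (intro congr_add_left congr_add_right) simp_all
  then show ?thesis using c congr_sym[of "\<ominus> y" "\<ominus> x"] by (simp add: add.cancel_inv_left)
qed

lemma congr_lam_right:
  assumes "congr x y" "a \<in> carrier B"
  shows "congr (lam a x) (lam a y)"
proof -
  have "lam a (x \<oplus> \<ominus> y) \<in> I" using assms I_lam by (simp add: congr_def)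
  then show ?thesis using assms by (simp add: congr_def lam_add lam_neg)
qed

lemma congr_lam_ideal: "i \<in> I \<Longrightarrow> b \<in> carrier B \<Longrightarrow> congr (lam i b) b"
  using I_star by (simp add: congr_def)

text \<open>
  Additive cosets are multiplicative cosets: \<open>x = y + i\<close> equals \<open>y j\<close> with \<open>j = \<lambda>\<^sub>y\<^sup>-\<^sup>1(i)\<close> in \<open>I\<close>, and
  \<open>j\<close> acts trivially modulo \<open>I\<close>.
\<close>

lemma congr_lam_left:
  assumes c: "congr x y" and b: "b \<in> carrier B"
  shows "congr (lam x b) (lam y b)"
proof -
  note xy = congr_carrier[OF c]
  define i where "i = \<ominus> y \<oplus> x"
  have "congr (\<ominus> y \<oplus> x) (\<ominus> y \<oplus> y)" using c xy by (intro congr_add) simp_all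
  then have i: "i \<in> I" using xy by (simp add: i_def congr_zero_iff)
  define j where "j = lam (inv y) i"
  have j: "j \<in> I" using i xy I_lam by (simp add: j_def)
  have "y \<otimes> j = x" using xy i j by (simp add: mult_lam j_def) (simp add: i_def add.cancel_inv_left)
  then have "lam x b = lam y (lam j b)" using xy b j lam_mult[of y j b] by simp
  then show ?thesis using congr_lam_right[OF congr_lam_ideal[OF j b] xy(2)] by simp
qed

lemma congr_mult:
  assumes c: "congr x x'" "congr y y'"
  shows "congr (x \<otimes> y) (x' \<otimes> y')"
proof -
  note k = congr_carrier[OF c(1)] congr_carrier[OF c(2)]
  have "congr (lam x y) (lam x' y')"
    using congr_trans[OF congr_lam_left[OF c(1) k(3)] congr_lam_right[OF c(2) k(2)]] .
  then show ?thesis using k congr_add[OF c(1)] by (simp add: mult_lam)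
qed

lemma congr_mult_inv:
  assumes "congr x y"
  shows "x \<otimes> inv y \<in> I"
proof -
  have "congr (x \<otimes> inv y) (y \<otimes> inv y)"
    using assms congr_carrier[OF assms] by (intro congr_mult) simp_all
  then show ?thesis using congr_carrier[OF assms] by (simp add: congr_zero_iff)
qed

lemma coset_eq_iff_congr:
  assumes "x \<in> carrier B" "y \<in> carrier B"
  shows "I +> x = I +> y \<longleftrightarrow> congr x y"
proof
  assume "I +> x = I +> y"
  then have "x \<in> I +> y"
    using add.rcos_self[OF assms(1) I_add_subgroup] by (simp add: a_r_coset_def)
  then obtain i where "i \<in> I" "x = i \<oplus> y" by (auto simp: a_r_coset_def r_coset_def)
  then show "congr x y" using assms by (simp add: congr_def add.m_assoc)
next
  assume "congr x y"
  then have "x \<oplus> \<ominus> y \<in> I" "x = (x \<oplus> \<ominus> y) \<oplus> y" using assms by (simp_all add: congr_def add.m_assoc)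
  then have "x \<in> I +> y" by (force simp: a_r_coset_def r_coset_def)
  then show "I +> x = I +> y"
    using add.repr_independence[OF _ assms(2) I_add_subgroup] by (simp add: a_r_coset_def)
qed

lemma mem_coset_congr: "x \<in> I +> y \<Longrightarrow> y \<in> carrier B \<Longrightarrow> congr x y"
  by (auto simp: a_r_coset_def r_coset_def congr_def add.m_assoc)

lemma Quot_carrier: "carrier (B Quot I) = (\<lambda>x. I +> x) ` carrier B"
  by (auto simp: FactRing_def A_RCOSETS_def RCOSETS_def a_r_coset_def)

lemma Quot_mult:
  assumes "x \<in> carrier B" "y \<in> carrier B"
  shows "(I +> x) \<otimes>\<^bsub>B Quot I\<^esub> (I +> y) = I +> (x \<otimes> y)"
proof -
  have eq: "I +> (a \<otimes> b) = I +> (x \<otimes> y)" if "a \<in> I +> x" "b \<in> I +> y" for a b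
  proof -
    have "congr a x" "congr b y" using that assms mem_coset_congr by blast+
    then show ?thesis
      using congr_mult congr_carrier assms by (subst coset_eq_iff_congr) simp_all
  qed
  have ne: "I +> x \<noteq> {}" "I +> y \<noteq> {}"
    using assms add.rcos_self[OF _ I_add_subgroup] by (auto simp: a_r_coset_def)
  have "(\<Union>a\<in>I +> x. \<Union>b\<in>I +> y. I +> (a \<otimes> b)) = (\<Union>a\<in>I +> x. \<Union>b\<in>I +> y. I +> (x \<otimes> y))"
    by (intro SUP_cong refl eq)
  also have "\<dots> = I +> (x \<otimes> y)" using ne by simp
  finally show ?thesis by (simp add: FactRing_def rcoset_mult_def)
qed

lemma Quot_add_monoid: "add_monoid (B Quot I) = add_monoid B Mod I"
  by (simp add: FactRing_def FactGroup_def A_RCOSETS_def set_add_def fun_eq_iff)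

lemma Quot_hom: "group_hom (add_monoid B) (add_monoid (B Quot I)) (\<lambda>x. I +> x)"
  unfolding Quot_add_monoid a_r_coset_def
  using normal.factorgroup_is_group[OF I_normal] normal.r_coset_hom_Mod[OF I_normal] add_group
  by (intro group_hom.intro group_hom_axioms.intro)

lemma Quot_add:
  assumes "x \<in> carrier B" "y \<in> carrier B"
  shows "(I +> x) \<oplus>\<^bsub>B Quot I\<^esub> (I +> y) = I +> (x \<oplus> y)"
  using group_hom.hom_mult[OF Quot_hom, of x y] assms by simp

lemma Quot_neg:
  assumes "x \<in> carrier B"
  shows "\<ominus>\<^bsub>B Quot I\<^esub> (I +> x) = I +> (\<ominus> x)"
  using group_hom.hom_inv[OF Quot_hom, of x] assms by (simp add: a_inv_def)

text \<open>
  The preimage in \<open>B\<close> of the centre of \<open>B/I\<close>. For \<open>I = Z\<^sub>i(B)\<close> it is \<open>Z\<^sub>i\<^sub>+\<^sub>1(B)\<close>.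
\<close>

definition Z_next :: "'a set"
  where "Z_next = {x \<in> carrier B. I +> x \<in> brace_center (B Quot I)}"

text \<open>
  Modulo \<open>I\<close>, once \<open>x\<close> acts trivially and is additively central, commuting with \<open>b\<close> in \<open>(B,\<cdot>)\<close> amounts
  to being fixed by \<open>\<lambda>\<^sub>b\<close>: then \<open>xb\<close> is congruent to \<open>x + b\<close>, hence to \<open>b + x\<close>, while
  \<open>bx = b + \<lambda>\<^sub>b(x)\<close>. This form of the condition is the one that is easily seen to define an ideal.
\<close>

lemma Z_next_iff:
  "x \<in> Z_next \<longleftrightarrow> x \<in> carrier B \<and>
    (\<forall>b\<in>carrier B. congr (lam x b) b \<and> congr (x \<oplus> b) (b \<oplus> x) \<and> congr (lam b x) x)"
proof (cases "x \<in> carrier B")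
  case True
  have l: "brace_lambda (B Quot I) (I +> x) (I +> b) = I +> b \<longleftrightarrow> congr (lam x b) b"
    if "b \<in> carrier B" for b
    using that True by (simp add: brace_lambda_def Quot_neg Quot_mult Quot_add coset_eq_iff_congr)
  have a: "(I +> x) \<oplus>\<^bsub>B Quot I\<^esub> (I +> b) = (I +> b) \<oplus>\<^bsub>B Quot I\<^esub> (I +> x) \<longleftrightarrow>
    congr (x \<oplus> b) (b \<oplus> x)" if "b \<in> carrier B" for b
    using that True by (simp add: Quot_add coset_eq_iff_congr)
  have m: "(I +> x) \<otimes>\<^bsub>B Quot I\<^esub> (I +> b) = (I +> b) \<otimes>\<^bsub>B Quot I\<^esub> (I +> x) \<longleftrightarrow>
    congr (x \<otimes> b) (b \<otimes> x)" if "b \<in> carrier B" for b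
    using that True by (simp add: Quot_mult coset_eq_iff_congr)
  have lm: "congr (x \<otimes> b) (b \<otimes> x) \<longleftrightarrow> congr (lam b x) x"
    if b: "b \<in> carrier B" and c: "congr (lam x b) b" "congr (x \<oplus> b) (b \<oplus> x)" for b
  proof -
    have "congr (x \<otimes> b) (x \<oplus> b)" using c(1) b True congr_add[of x x] by (simp add: mult_lam)
    then have xb: "congr (x \<otimes> b) (b \<oplus> x)" using congr_trans c(2) by blast
    show ?thesis
    proof
      assume "congr (x \<otimes> b) (b \<otimes> x)"
      then have "congr (b \<oplus> lam b x) (b \<oplus> x)"
        using xb congr_trans congr_sym b True by (metis mult_lam)
      then have "congr (\<ominus> b \<oplus> (b \<oplus> lam b x)) (\<ominus> b \<oplus> (b \<oplus> x))"
        using b by (rule congr_add_left[OF _ add.inv_closed])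
      then show "congr (lam b x) x" using b True by (simp add: add.cancel_inv_left)
    next
      assume "congr (lam b x) x"
      then have "congr (b \<otimes> x) (b \<oplus> x)" using b True congr_add[of b b] by (simp add: mult_lam)
      then show "congr (x \<otimes> b) (b \<otimes> x)" using xb congr_trans congr_sym by blast
    qed
  qed
  have "I +> x \<in> carrier (B Quot I)" using True Quot_carrier by blast
  then have "I +> x \<in> brace_center (B Quot I) \<longleftrightarrow>
    (\<forall>b\<in>carrier B. congr (lam x b) b) \<and> (\<forall>b\<in>carrier B. congr (x \<oplus> b) (b \<oplus> x)) \<and>
    (\<forall>b\<in>carrier B. congr (x \<otimes> b) (b \<otimes> x))"
    using l a m by (simp add: brace_center_def ker_lambda_def group_center_def Quot_carrier)
  then show ?thesis using True lm by (auto simp: Z_next_def)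
qed (simp add: Z_next_def)

lemma Z_next_mult_commute:
  assumes x: "x \<in> Z_next" and b: "b \<in> carrier B"
  shows "congr (x \<otimes> b) (b \<otimes> x)"
proof -
  have c: "x \<in> carrier B" "congr (lam x b) b" "congr (x \<oplus> b) (b \<oplus> x)" "congr (lam b x) x"
    using x b by (simp_all add: Z_next_iff)
  have "congr (x \<oplus> lam x b) (x \<oplus> b)" "congr (b \<oplus> x) (b \<oplus> lam b x)"
    using c congr_sym[OF c(4)] b by (intro congr_add; simp)+
  then have "congr (x \<oplus> lam x b) (b \<oplus> lam b x)" using c(3) congr_trans by blast
  then show ?thesis using c(1) b by (simp add: mult_lam)
qed

lemma Z_next_congr:
  assumes x: "x \<in> Z_next" and xy: "congr y x"
  shows "y \<in> Z_next"
  unfolding Z_next_iff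
proof (intro conjI ballI)
  show y: "y \<in> carrier B" using congr_carrier[OF xy] by simp
  fix b assume b: "b \<in> carrier B"
  have c: "x \<in> carrier B" "congr (lam x b) b" "congr (x \<oplus> b) (b \<oplus> x)" "congr (lam b x) x"
    using x b by (simp_all add: Z_next_iff)
  show "congr (lam y b) b" using congr_trans[OF congr_lam_left[OF xy b] c(2)] .
  have "congr (y \<oplus> b) (x \<oplus> b)" using xy b by (intro congr_add) simp_all
  also note c(3)
  also have "congr (b \<oplus> x) (b \<oplus> y)" using congr_sym[OF xy] b by (intro congr_add) simp_all
  finally show "congr (y \<oplus> b) (b \<oplus> y)" .
  show "congr (lam b y) y"
    using congr_trans[OF congr_lam_right[OF xy b] congr_trans[OF c(4) congr_sym[OF xy]]] .
qed

lemma ideal_subset_Z_next: "I \<subseteq> Z_next"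
proof
  fix i assume "i \<in> I"
  moreover have "\<zero> \<in> Z_next" by (simp add: Z_next_iff)
  ultimately show "i \<in> Z_next" using Z_next_congr congr_zero_iff by blast
qed

text \<open>
  Conjugates \<open>b + x - b\<close> and images \<open>\<lambda>\<^sub>b(x)\<close> are congruent to \<open>x\<close>, and \<open>\<lambda>\<^sub>x(b) - b\<close> lies in \<open>I\<close>; since \<open>Z_next\<close>
  is a union of cosets of \<open>I\<close>, only the additive subgroup axioms need an argument.
\<close>

lemma Z_next_ideal: "brace_ideal Z_next B"
proof (rule brace_idealI)
  have sub: "subgroup Z_next (add_monoid B)"
  proof (rule add.subgroupI)
    show "Z_next \<subseteq> carrier B" by (auto simp: Z_next_def)
    show "Z_next \<noteq> {}" using ideal_subset_Z_next I_zero by blast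
  next
    fix x assume x: "x \<in> Z_next"
    then have xc: "x \<in> carrier B" by (simp add: Z_next_iff)
    show "\<ominus> x \<in> Z_next"
      unfolding Z_next_iff
    proof (intro conjI ballI)
      show "\<ominus> x \<in> carrier B" using xc by simp
      fix b assume b: "b \<in> carrier B"
      have c: "congr (lam x c) c" "congr (x \<oplus> c) (c \<oplus> x)" "congr (lam c x) x" if "c \<in> carrier B" for c
        using x that by (simp_all add: Z_next_iff)
      have "congr (x \<oplus> lam x (\<ominus> x)) (x \<oplus> \<ominus> x)" using c(1) xc by (intro congr_add) simp_all
      then have z: "congr (x \<otimes> \<ominus> x) \<zero>" using xc by (simp add: mult_lam)
      \<comment> \<open>\<open>x\<close> acts trivially on \<open>lam (\<ominus> x) b\<close>, and \<open>x \<otimes> \<ominus> x\<close> is congruent to \<open>\<zero>\<close>\<close>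
      have "congr (lam (\<ominus> x) b) (lam x (lam (\<ominus> x) b))" using xc b by (intro congr_sym[OF c(1)]) simp
      also have "lam x (lam (\<ominus> x) b) = lam (x \<otimes> \<ominus> x) b" using xc b by (simp add: lam_mult)
      also have "congr (lam (x \<otimes> \<ominus> x) b) b" using congr_lam_left[OF z b] b by simp
      finally show "congr (lam (\<ominus> x) b) b" .
      have "congr (\<ominus> x \<oplus> (b \<oplus> x) \<oplus> \<ominus> x) (\<ominus> x \<oplus> (x \<oplus> b) \<oplus> \<ominus> x)"
        using congr_sym[OF c(2)[OF b]] xc by (intro congr_add_left congr_add_right) simp_all
      then show "congr (\<ominus> x \<oplus> b) (b \<oplus> \<ominus> x)"
        using xc b by (simp add: add.m_assoc add.cancel_inv_left)
      show "congr (lam b (\<ominus> x)) (\<ominus> x)" using congr_neg[OF c(3)[OF b]] xc b by (simp add: lam_neg)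
    qed
  next
    fix x y assume xy: "x \<in> Z_next" "y \<in> Z_next"
    then have c: "x \<in> carrier B" "y \<in> carrier B" by (simp_all add: Z_next_iff)
    have "x \<oplus> y \<in> Z_next"
      unfolding Z_next_iff
    proof (intro conjI ballI)
      show "x \<oplus> y \<in> carrier B" using c by simp
      fix b assume b: "b \<in> carrier B"
      have x: "congr (lam x d) d" "congr (x \<oplus> d) (d \<oplus> x)" "congr (lam d x) x"
        and y: "congr (lam y d) d" "congr (y \<oplus> d) (d \<oplus> y)" "congr (lam d y) y"
        if "d \<in> carrier B" for d
        using xy that by (simp_all add: Z_next_iff)
      have "congr (x \<oplus> y) (x \<oplus> lam x y)" using congr_sym[OF x(1)[OF c(2)]] c by (intro congr_add) simp_all
      then have "congr (x \<oplus> y) (x \<otimes> y)" using c by (simp add: mult_lam)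
      from congr_lam_left[OF this b] have "congr (lam (x \<oplus> y) b) (lam x (lam y b))"
        using c b by (simp add: lam_mult)
      also have "congr (lam x (lam y b)) (lam y b)" using x(1) c b by simp
      also have "congr (lam y b) b" using y(1) b .
      finally show "congr (lam (x \<oplus> y) b) b" .
      have "congr (x \<oplus> (y \<oplus> b)) (x \<oplus> (b \<oplus> y))" using congr_add_left[OF y(2)[OF b] c(1)] .
      moreover have "congr ((x \<oplus> b) \<oplus> y) ((b \<oplus> x) \<oplus> y)" using congr_add_right[OF x(2)[OF b] c(2)] .
      ultimately show "congr (x \<oplus> y \<oplus> b) (b \<oplus> (x \<oplus> y))"
        using c b congr_trans by (simp add: add.m_assoc)
      show "congr (lam b (x \<oplus> y)) (x \<oplus> y)"
        using congr_add[OF x(3)[OF b] y(3)[OF b]] c b by (simp add: lam_add)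
    qed
    then show "x \<oplus>\<^bsub>B\<^esub> y \<in> Z_next" .
  qed
  show "Z_next \<lhd> add_monoid B"
  proof (rule add.normal_invI[OF sub])
    fix b x assume b: "b \<in> carrier B" and x: "x \<in> Z_next"
    have c: "x \<in> carrier B" "congr (x \<oplus> b) (b \<oplus> x)" using x b by (simp_all add: Z_next_iff)
    have "congr (b \<oplus> x \<oplus> \<ominus> b) (x \<oplus> b \<oplus> \<ominus> b)" using congr_sym[OF c(2)] b by (intro congr_add_right) simp_all
    then have "congr (b \<oplus> x \<oplus> \<ominus> b) x" using c b by (simp add: add.m_assoc)
    then show "b \<oplus> x \<oplus> \<ominus> b \<in> Z_next" using Z_next_congr[OF x] by blast
  qed
  fix b x assume b: "b \<in> carrier B" and x: "x \<in> Z_next"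
  then have "congr (lam b x) x" "lam x b \<oplus> \<ominus> b \<in> I" by (auto simp: Z_next_iff congr_def)
  then show "lam b x \<in> Z_next" "lam x b \<oplus> \<ominus> b \<in> Z_next"
    using Z_next_congr[OF x] ideal_subset_Z_next by blast+
qed

end

context skew_brace
begin

lemma upper_central_ideal: "brace_ideal (upper_central B i) B"
proof (induction i)
  case 0
  show ?case using brace_ideal_zero by simp
next
  case (Suc i)
  then interpret I: skew_brace_ideal B "upper_central B i" by unfold_locales
  show ?case using I.Z_next_ideal by (simp add: I.Z_next_def)
qed

end

section \<open>The semidirect product\<close>

context skew_brace
begin

text \<open>
  The factor \<open>(B,\<cdot>)\<close>, written second, acts on the factor \<open>(B,+)\<close> through \<open>\<lambda>\<close>. The identity of \<open>(B,\<cdot>)\<close> appears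
  as \<open>\<zero>\<close>, with which it coincides.
\<close>

definition semidirect :: "('a \<times> 'a) monoid"
  where "semidirect = \<lparr>carrier = carrier B \<times> carrier B,
    mult = (\<lambda>(a, c) (b, d). (a \<oplus> lam c b, c \<otimes> d)), one = (\<zero>, \<zero>)\<rparr>"

lemma semidirect_carrier: "carrier semidirect = carrier B \<times> carrier B"
  by (simp add: semidirect_def)

lemma semidirect_mult [simp]: "(a, c) \<otimes>\<^bsub>semidirect\<^esub> (b, d) = (a \<oplus> lam c b, c \<otimes> d)"
  by (simp add: semidirect_def)

lemma semidirect_one [simp]: "\<one>\<^bsub>semidirect\<^esub> = (\<zero>, \<zero>)"
  by (simp add: semidirect_def)

lemma semidirect_group: "group semidirect"
proof (rule groupI)
  fix X Y W assume "X \<in> carrier semidirect" "Y \<in> carrier semidirect" "W \<in> carrier semidirect"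
  then show "X \<otimes>\<^bsub>semidirect\<^esub> Y \<otimes>\<^bsub>semidirect\<^esub> W = X \<otimes>\<^bsub>semidirect\<^esub> (Y \<otimes>\<^bsub>semidirect\<^esub> W)"
    by (auto simp: semidirect_carrier lam_add lam_mult add.m_assoc M.m_assoc)
next
  fix X assume "X \<in> carrier semidirect"
  then obtain a c where X: "X = (a, c)" "a \<in> carrier B" "c \<in> carrier B"
    by (auto simp: semidirect_carrier)
  then have "(lam (inv c) (\<ominus> a), inv c) \<otimes>\<^bsub>semidirect\<^esub> X = \<one>\<^bsub>semidirect\<^esub>"
    by (simp add: lam_add[symmetric])
  then show "\<exists>Y\<in>carrier semidirect. Y \<otimes>\<^bsub>semidirect\<^esub> X = \<one>\<^bsub>semidirect\<^esub>"
    using X by (intro bexI[of _ "(lam (inv c) (\<ominus> a), inv c)"]) (simp_all add: semidirect_carrier)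
qed (auto simp: semidirect_carrier)

end

sublocale skew_brace \<subseteq> G: group semidirect
  by (rule semidirect_group)

context skew_brace
begin

lemma semidirect_inv [simp]:
  assumes "a \<in> carrier B" "c \<in> carrier B"
  shows "inv\<^bsub>semidirect\<^esub> (a, c) = (lam (inv c) (\<ominus> a), inv c)"
  using assms by (intro G.inv_equality) (simp_all add: semidirect_carrier lam_add[symmetric])

end

context skew_brace_ideal
begin

lemma semidirect_div_mem:
  assumes pq: "congr p q" and rs: "congr r s"
  shows "(p, r) \<otimes>\<^bsub>semidirect\<^esub> inv\<^bsub>semidirect\<^esub> (q, s) \<in> I \<times> I"
proof -
  note c = congr_carrier[OF pq] congr_carrier[OF rs]
  have t: "r \<otimes> inv s \<in> I" using congr_mult_inv[OF rs] .
  have "congr (p \<oplus> lam (r \<otimes> inv s) (\<ominus> q)) (q \<oplus> \<ominus> q)"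
    using congr_add[OF pq congr_lam_ideal[OF t, of "\<ominus> q"]] c by simp
  then have "p \<oplus> lam r (lam (inv s) (\<ominus> q)) \<in> I" using c by (simp add: lam_mult congr_zero_iff)
  then show ?thesis using c t by simp
qed

lemma semidirect_ideal_subgroup: "subgroup (I \<times> I) semidirect"
proof (rule G.subgroupI)
  show "I \<times> I \<noteq> {}" using I_zero by blast
  fix X Y assume "X \<in> I \<times> I" "Y \<in> I \<times> I"
  then show "X \<otimes>\<^bsub>semidirect\<^esub> Y \<in> I \<times> I"
    using subgroup.m_closed[OF I_mult_subgroup] I_lam by auto
next
  fix X assume "X \<in> I \<times> I"
  then show "inv\<^bsub>semidirect\<^esub> X \<in> I \<times> I"
    using subgroup.m_inv_closed[OF I_mult_subgroup] I_lam by auto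
qed (auto simp: semidirect_carrier)

lemma semidirect_coset_eq:
  assumes "congr p q" "congr r s"
  shows "(I \<times> I) #>\<^bsub>semidirect\<^esub> (p, r) = (I \<times> I) #>\<^bsub>semidirect\<^esub> (q, s)"
proof -
  let ?X = "(p, r)" and ?Y = "(q, s)"
  have c: "?X \<in> carrier semidirect" "?Y \<in> carrier semidirect"
    using assms by (simp_all add: semidirect_carrier congr_def)
  have eq: "?X = (?X \<otimes>\<^bsub>semidirect\<^esub> inv\<^bsub>semidirect\<^esub> ?Y) \<otimes>\<^bsub>semidirect\<^esub> ?Y"
    using c by (simp only: G.m_assoc G.l_inv G.r_one G.inv_closed)
  have "?X \<in> (I \<times> I) #>\<^bsub>semidirect\<^esub> ?Y"
    unfolding r_coset_def
    by (rule UN_I[OF semidirect_div_mem[OF assms]], rule iffD2[OF singleton_iff], rule eq)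
  then show ?thesis using G.repr_independence[OF _ c(2) semidirect_ideal_subgroup] by simp
qed

lemma finite_semidirect_cosets:
  assumes fin: "finite (carrier (B Quot I))"
  shows "finite ((\<lambda>X. (I \<times> I) #>\<^bsub>semidirect\<^esub> X) ` carrier semidirect)"
proof -
  have "finite ((\<lambda>x. I +> x) ` carrier B)" using fin by (simp add: Quot_carrier)
  then obtain T where T: "T \<subseteq> carrier B" "finite T" "(\<lambda>x. I +> x) ` carrier B = (\<lambda>x. I +> x) ` T"
    using finite_subset_image[OF _ subset_refl] by metis
  have rep: "\<exists>t\<in>T. congr x t" if x: "x \<in> carrier B" for x
  proof -
    have "I +> x \<in> (\<lambda>x. I +> x) ` T" using T(3) x by blast
    then obtain t where "t \<in> T" "I +> x = I +> t" by blast
    then show ?thesis using coset_eq_iff_congr[OF x] T(1) by blast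
  qed
  have "(\<lambda>X. (I \<times> I) #>\<^bsub>semidirect\<^esub> X) ` carrier semidirect
      \<subseteq> (\<lambda>X. (I \<times> I) #>\<^bsub>semidirect\<^esub> X) ` (T \<times> T)"
  proof
    fix K assume "K \<in> (\<lambda>X. (I \<times> I) #>\<^bsub>semidirect\<^esub> X) ` carrier semidirect"
    then obtain a c where ac: "a \<in> carrier B" "c \<in> carrier B" "K = (I \<times> I) #>\<^bsub>semidirect\<^esub> (a, c)"
      by (auto simp: semidirect_carrier)
    obtain s t where st: "s \<in> T" "congr a s" "t \<in> T" "congr c t" using rep ac by blast
    then have "K = (I \<times> I) #>\<^bsub>semidirect\<^esub> (s, t)" using ac semidirect_coset_eq by simp
    then show "K \<in> (\<lambda>X. (I \<times> I) #>\<^bsub>semidirect\<^esub> X) ` (T \<times> T)" using st by blast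
  qed
  then show ?thesis by (rule finite_subset) (simp add: T(2))
qed

text \<open>
  For \<open>z, w \<in> Z_next\<close> the products \<open>(z,w)(a,c) = (z + \<lambda>\<^sub>w(a), wc)\<close> and
  \<open>(a,c)(z,w) = (a + \<lambda>\<^sub>c(z), cw)\<close> agree modulo \<open>I\<close> in both components.
\<close>

lemma semidirect_commutator_Z_next:
  assumes X: "X \<in> Z_next \<times> Z_next" and Y: "Y \<in> carrier semidirect"
  shows "G.commutator X Y \<in> I \<times> I"
proof -
  obtain z w where z: "X = (z, w)" "z \<in> Z_next" "w \<in> Z_next" using X by blast
  obtain a c where a: "Y = (a, c)" "a \<in> carrier B" "c \<in> carrier B"
    using Y by (auto simp: semidirect_carrier)
  have zc: "z \<in> carrier B" "w \<in> carrier B" using z by (simp_all add: Z_next_iff)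
  have Xc: "X \<in> carrier semidirect" using z zc by (simp add: semidirect_carrier)
  have "congr (z \<oplus> lam w a) (z \<oplus> a)"
    using z a by (intro congr_add_left) (simp_all add: Z_next_iff)
  also have "congr (z \<oplus> a) (a \<oplus> z)" using z a by (simp add: Z_next_iff)
  also have "congr (a \<oplus> z) (a \<oplus> lam c z)"
    using z a by (intro congr_add_left congr_sym[of "lam c z"]) (simp_all add: Z_next_iff)
  finally have 1: "congr (z \<oplus> lam w a) (a \<oplus> lam c z)" .
  have 2: "congr (w \<otimes> c) (c \<otimes> w)" using Z_next_mult_commute z a by blast
  \<comment> \<open>a commutator is the quotient of the two products\<close>
  have "G.commutator X Y =
      (X \<otimes>\<^bsub>semidirect\<^esub> Y) \<otimes>\<^bsub>semidirect\<^esub> inv\<^bsub>semidirect\<^esub> (Y \<otimes>\<^bsub>semidirect\<^esub> X)"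
    using Xc Y by (simp only: G.m_assoc G.inv_mult_group G.inv_closed G.m_closed)
  also have "\<dots> \<in> I \<times> I"
    unfolding z(1) a(1) semidirect_mult by (rule semidirect_div_mem[OF 1 2])
  finally show ?thesis .
qed

end

context skew_brace
begin

lemma semidirect_central_chain:
  "central_chain semidirect (\<lambda>i. upper_central B i \<times> upper_central B i)"
proof (intro central_chain.intro central_chain_axioms.intro semidirect_group)
  fix i
  interpret I: skew_brace_ideal B "upper_central B i"
    by unfold_locales (rule upper_central_ideal)
  have Suc: "upper_central B (Suc i) = I.Z_next" by (simp add: I.Z_next_def)
  show "subgroup (upper_central B i \<times> upper_central B i) semidirect"
    by (rule I.semidirect_ideal_subgroup)
  show "upper_central B i \<times> upper_central B i \<subseteq> upper_central B (Suc i) \<times> upper_central B (Suc i)"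
    unfolding Suc using I.ideal_subset_Z_next by blast
  show "G.commutator z g \<in> upper_central B i \<times> upper_central B i"
    if "z \<in> upper_central B (Suc i) \<times> upper_central B (Suc i)" "g \<in> carrier semidirect" for z g
    using I.semidirect_commutator_Z_next that unfolding Suc by blast
qed

lemma finite_semidirect_commutator_series:
  assumes "finite (carrier (B Quot upper_central B n))"
  shows "finite (G.commutator_series n)"
proof -
  interpret I: skew_brace_ideal B "upper_central B n"
    by unfold_locales (rule upper_central_ideal)
  show ?thesis
    by (rule central_chain.finite_commutator_series[OF semidirect_central_chain])
      (use I.finite_semidirect_cosets assms in simp_all)
qed

section \<open>Traces of the lower central series\<close>

text \<open>
  The trace on \<open>(B,+)\<close> of the lower central series of the semidirect product. As for
  \<open>commutator_series\<close>, the index starts at 0.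
\<close>

definition additive_series :: "nat \<Rightarrow> 'a set"
  where "additive_series k = {a \<in> carrier B. (a, \<zero>) \<in> G.commutator_series k}"

lemma additive_series_0: "additive_series 0 = carrier B"
  by (simp add: additive_series_def semidirect_carrier)

text \<open>
  The terms of the lower central series are normal in the semidirect product. Conjugation by
  \<open>(b,0)\<close> restricts to additive conjugation by \<open>b\<close>, and conjugation by \<open>(0,b)\<close> to \<open>\<lambda>\<^sub>b\<close>.
\<close>

lemma additive_series_normal: "additive_series k \<lhd> add_monoid B"
  and additive_series_lam: "b \<in> carrier B \<Longrightarrow> i \<in> additive_series k \<Longrightarrow> lam b i \<in> additive_series k"
proof -
  let ?L = "G.commutator_series k"
  have N: "?L \<lhd> semidirect" by (rule G.commutator_series_normal)
  have sub: "subgroup ?L semidirect" using N by (rule normal_imp_subgroup)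
  have conj: "X \<otimes>\<^bsub>semidirect\<^esub> Y \<otimes>\<^bsub>semidirect\<^esub> inv\<^bsub>semidirect\<^esub> X \<in> ?L"
    if "X \<in> carrier semidirect" "Y \<in> ?L" for X Y
    using normal.inv_op_closed2[OF N that] .
  have "subgroup (additive_series k) (add_monoid B)"
  proof (rule add.subgroupI)
    show "additive_series k \<noteq> {}"
      using subgroup.one_closed[OF sub] by (auto simp: additive_series_def)
    show "\<ominus> a \<in> additive_series k" if "a \<in> additive_series k" for a
      using subgroup.m_inv_closed[OF sub, of "(a, \<zero>)"] that
      by (simp add: additive_series_def M.inv_one[unfolded one_zero])
    show "a \<oplus> b \<in> additive_series k" if "a \<in> additive_series k" "b \<in> additive_series k" for a b
      using subgroup.m_closed[OF sub, of "(a, \<zero>)" "(b, \<zero>)"] that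
      by (simp add: additive_series_def)
  qed (auto simp: additive_series_def)
  then show "additive_series k \<lhd> add_monoid B"
  proof (rule add.normal_invI)
    fix b i assume "b \<in> carrier B" "i \<in> additive_series k"
    then show "b \<oplus> i \<oplus> \<ominus> b \<in> additive_series k"
      using conj[of "(b, \<zero>)" "(i, \<zero>)"]
      by (simp add: additive_series_def semidirect_carrier M.inv_one[unfolded one_zero])
  qed
  show "lam b i \<in> additive_series k" if "b \<in> carrier B" "i \<in> additive_series k"
    using that conj[of "(\<zero>, b)" "(i, \<zero>)"]
    by (simp add: additive_series_def semidirect_carrier)
qed

lemma commutator_in_series:
  assumes "X \<in> G.commutator_series k" "Y \<in> carrier semidirect"
  shows "G.commutator X Y \<in> G.commutator_series (Suc k)"
  using assms unfolding G.commutator_series.simps commutator_subgroup_def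
  by (intro generate.incl) blast

text \<open>
  Commutators in the semidirect product of \<open>(i,0)\<close> with \<open>(b,0)\<close> and with \<open>(b,b)\<close>, and of \<open>(0,c)\<close> with
  \<open>(b,0)\<close>. The second one is the multiplicative commutator of \<open>i\<close> and \<open>b\<close> when \<open>i\<close> and that commutator lie in \<open>ker \<lambda>\<close>.
\<close>

lemma additive_commutator_mem:
  assumes "i \<in> additive_series k" "b \<in> carrier B"
  shows "i \<oplus> b \<oplus> \<ominus> i \<oplus> \<ominus> b \<in> additive_series (Suc k)"
  using assms commutator_in_series[of "(i, \<zero>)" k "(b, \<zero>)"]
  by (simp add: additive_series_def semidirect_carrier M.inv_one[unfolded one_zero] del: G.commutator_series.simps)

lemma twisted_commutator_mem:
  assumes "i \<in> additive_series k" "b \<in> carrier B"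
  shows "i \<oplus> b \<oplus> \<ominus> lam b i \<oplus> \<ominus> b \<in> additive_series (Suc k)"
  using assms commutator_in_series[of "(i, \<zero>)" k "(b, b)"]
  by (simp add: additive_series_def semidirect_carrier M.inv_one[unfolded one_zero] lam_neg lam_mult[symmetric]
    del: G.commutator_series.simps)

lemma star_mem_additive_series:
  assumes "c \<in> carrier B" "b \<in> carrier B"
  shows "lam c b \<oplus> \<ominus> b \<in> additive_series (Suc 0)"
  using assms commutator_in_series[of "(\<zero>, c)" 0 "(b, \<zero>)"]
  by (simp add: additive_series_def semidirect_carrier M.inv_one[unfolded one_zero] lam_mult[symmetric]
    del: G.commutator_series.simps(2))

lemma additive_series_Suc_0_ideal: "brace_ideal (additive_series (Suc 0)) B"
  by (intro brace_idealI additive_series_normal additive_series_lam star_mem_additive_series)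
    (auto simp: additive_series_def)

lemma ideal_commutator_subset:
  assumes J: "brace_ideal J B"
    and add: "\<And>i b. i \<in> X \<Longrightarrow> b \<in> carrier B \<Longrightarrow> i \<oplus> b \<oplus> \<ominus> i \<oplus> \<ominus> b \<in> J"
    and mult: "\<And>i b. i \<in> X \<Longrightarrow> b \<in> carrier B \<Longrightarrow> i \<otimes> b \<otimes> inv i \<otimes> inv b \<in> J"
    and mixed: "\<And>i b. i \<in> X \<Longrightarrow> b \<in> carrier B \<Longrightarrow> (i \<otimes> b) \<oplus> \<ominus> (i \<oplus> b) \<in> J"
  shows "ideal_commutator B X (carrier B) \<subseteq> J"
proof -
  have sub: "subgroup J (add_monoid B)" "subgroup J B"
    using J by (auto simp: brace_ideal_def subbrace_def)
  have "commutator_subgroup (add_monoid B) X (carrier B) \<subseteq> J"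
    unfolding commutator_subgroup_def
    by (rule add.generate_subgroup_incl[OF _ sub(1)]) (use add in \<open>auto simp: a_inv_def\<close>)
  moreover have "commutator_subgroup B X (carrier B) \<subseteq> J"
    unfolding commutator_subgroup_def
    by (rule M.generate_subgroup_incl[OF _ sub(2)]) (use mult in auto)
  moreover have "{(i \<otimes> j) \<ominus> (i \<oplus> j) | i j. i \<in> X \<and> j \<in> carrier B} \<subseteq> J"
    using mixed by (auto simp: a_minus_def)
  ultimately show ?thesis
    unfolding ideal_commutator_def ideal_generated_def using J by blast
qed

text \<open>
  Modulo the ideal on the right, \<open>ab\<close> is congruent to \<open>a + b\<close> because \<open>a * b\<close> lies in it, and \<open>a + b\<close> is
  congruent to \<open>b + a\<close>; so \<open>ab\<close> is also congruent to \<open>ba\<close>.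
\<close>

lemma derived_ideal_subset_additive_series: "derived_ideal B \<subseteq> additive_series (Suc 0)"
proof -
  interpret J: skew_brace_ideal B "additive_series (Suc 0)"
    by unfold_locales (rule additive_series_Suc_0_ideal)
  have comm: "i \<oplus> b \<oplus> \<ominus> i \<oplus> \<ominus> b \<in> additive_series (Suc 0)"
    if i: "i \<in> carrier B" and b: "b \<in> carrier B" for i b
  proof -
    have "i \<in> additive_series 0" using i by (simp only: additive_series_0)
    then show ?thesis by (rule additive_commutator_mem[OF _ b])
  qed
  have mult: "J.congr (i \<otimes> b) (i \<oplus> b)" if "i \<in> carrier B" "b \<in> carrier B" for i b
    using that star_mem_additive_series[of i b]
    by (simp add: mult_lam J.congr_add_left J.congr_def[of "lam i b" b])
  have plus: "J.congr (i \<oplus> b) (b \<oplus> i)" if "i \<in> carrier B" "b \<in> carrier B" for i b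
    using that comm[of i b] by (simp add: J.congr_def add.inv_mult_group add.m_assoc)
  show ?thesis
    unfolding derived_ideal_def
  proof (rule ideal_commutator_subset[OF additive_series_Suc_0_ideal comm])
    fix i b assume c: "i \<in> carrier B" "b \<in> carrier B"
    show "(i \<otimes> b) \<oplus> \<ominus> (i \<oplus> b) \<in> additive_series (Suc 0)"
      using mult[OF c] by (simp add: J.congr_def)
    have "J.congr (i \<otimes> b) (b \<otimes> i)"
      using J.congr_trans[OF mult[OF c] J.congr_trans[OF plus[OF c] J.congr_sym[OF mult[OF c(2,1)]]]] .
    then show "i \<otimes> b \<otimes> inv i \<otimes> inv b \<in> additive_series (Suc 0)"
      using J.congr_mult_inv c by (metis M.inv_mult_group M.m_assoc M.m_closed M.inv_closed)
  qed
qed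

text \<open>
  An intersection of ideals is an ideal if the family is not empty; here it contains \<open>carrier B\<close>.
\<close>

lemma derived_ideal_ideal: "brace_ideal (derived_ideal B) B"
proof -
  define F where "F = {I. brace_ideal I B \<and>
    commutator_subgroup (add_monoid B) (carrier B) (carrier B) \<union> commutator_subgroup B (carrier B) (carrier B)
      \<union> {(i \<otimes> j) \<ominus> (i \<oplus> j) | i j. i \<in> carrier B \<and> j \<in> carrier B} \<subseteq> I}"
  have D: "derived_ideal B = \<Inter>F"
    by (simp add: derived_ideal_def ideal_commutator_def ideal_generated_def F_def)
  have F: "skew_brace_ideal B I" if "I \<in> F" for I
    using that by unfold_locales (simp add: F_def)
  have "commutator_subgroup (add_monoid B) (carrier B) (carrier B) \<subseteq> carrier B"
    unfolding commutator_subgroup_def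
    by (rule add.generate_incl) (auto simp: a_inv_def[symmetric])
  moreover have "commutator_subgroup B (carrier B) (carrier B) \<subseteq> carrier B"
    unfolding commutator_subgroup_def by (rule M.generate_incl) auto
  ultimately have ne: "carrier B \<in> F"
    using brace_ideal_carrier by (auto simp: F_def a_minus_def)
  have "subgroup (\<Inter>F) (add_monoid B)"
    using add.subgroups_Inter[of F] skew_brace_ideal.I_add_subgroup[OF F] ne by blast
  then have "\<Inter>F \<lhd> add_monoid B"
    by (rule add.normal_invI) (use skew_brace_ideal.I_conj[OF F] in blast)
  then show ?thesis
    unfolding D
    by (rule brace_idealI) (use skew_brace_ideal.I_lam[OF F] skew_brace_ideal.I_star[OF F] in blast)+
qed

text \<open>
  The intersection with the derived ideal is carried through the induction because it lies in \<open>ker \<lambda>\<close>: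
  there \<open>i * b = 0\<close>, so that normality and stability under \<open>\<lambda>\<close> suffice for an ideal, and \<open>ib = i + b\<close>.
\<close>

lemma lower_central_subset_additive_series:
  assumes ker: "derived_ideal B \<subseteq> ker_lambda B"
  shows "lower_central B (Suc (Suc k)) \<subseteq> additive_series (Suc k) \<inter> derived_ideal B"
proof (induction k)
  case 0
  show ?case using derived_ideal_subset_additive_series by (simp add: derived_ideal_def)
next
  case (Suc k)
  interpret D: skew_brace_ideal B "derived_ideal B"
    by unfold_locales (rule derived_ideal_ideal)
  let ?J = "additive_series (Suc (Suc k)) \<inter> derived_ideal B"
  have lam: "lam i b = b" if "i \<in> derived_ideal B" "b \<in> carrier B" for i b
    using that ker by (auto simp: ker_lambda_def)
  have J: "brace_ideal ?J B"
  proof (rule brace_idealI)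
    show "?J \<lhd> add_monoid B"
      using add.normal_subgroup_intersect[OF additive_series_normal D.I_normal] .
    fix b i assume "b \<in> carrier B" "i \<in> ?J"
    then show "lam b i \<in> ?J" using additive_series_lam D.I_lam by blast
  next
    fix b i assume "b \<in> carrier B" "i \<in> ?J"
    then show "lam i b \<oplus> \<ominus> b \<in> ?J"
      using lam normal_imp_subgroup[OF additive_series_normal, THEN subgroup.one_closed] by simp
  qed
  have "ideal_commutator B (lower_central B (Suc (Suc k))) (carrier B) \<subseteq> ?J"
  proof (rule ideal_commutator_subset[OF J])
    fix i b assume i: "i \<in> lower_central B (Suc (Suc k))" and b: "b \<in> carrier B"
    have iJ: "i \<in> additive_series (Suc k)" "i \<in> derived_ideal B" using i Suc by blast+
    have ic: "i \<in> carrier B" using iJ by simp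
    have conj: "b \<oplus> \<ominus> j \<oplus> \<ominus> b \<in> derived_ideal B" if "j \<in> derived_ideal B" for j
      using D.I_conj[of "\<ominus> j" b] that b by simp
    have "i \<oplus> (b \<oplus> \<ominus> i \<oplus> \<ominus> b) \<in> derived_ideal B" using conj iJ by simp
    then show "i \<oplus> b \<oplus> \<ominus> i \<oplus> \<ominus> b \<in> ?J"
      using additive_commutator_mem[OF iJ(1) b] ic b by (simp add: add.m_assoc)
    \<comment> \<open>the multiplicative commutator of \<open>i\<close> and \<open>b\<close> in additive terms, since \<open>i\<close> and \<open>?t\<close> act trivially\<close>
    let ?t = "i \<oplus> b \<oplus> \<ominus> lam b i \<oplus> \<ominus> b"
    have "i \<oplus> (b \<oplus> \<ominus> lam b i \<oplus> \<ominus> b) \<in> derived_ideal B"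
      using conj[OF D.I_lam[OF iJ(2) b]] iJ by simp
    then have t: "?t \<in> derived_ideal B" using ic b by (simp add: add.m_assoc)
    have "?t \<otimes> (b \<otimes> i) = ?t \<oplus> (b \<otimes> i)" using t b ic lam by (simp add: mult_lam[of ?t])
    also have "\<dots> = i \<oplus> b" using b ic by (simp add: mult_lam[of b i] add.m_assoc add.cancel_inv_left)
    also have "\<dots> = i \<otimes> b" using b ic lam[OF iJ(2) b] by (simp add: mult_lam)
    finally have "?t \<otimes> (b \<otimes> i) \<otimes> inv (b \<otimes> i) = i \<otimes> b \<otimes> inv (b \<otimes> i)" by simp
    then have "?t = i \<otimes> b \<otimes> inv i \<otimes> inv b"
      using b ic by (simp add: M.m_assoc M.inv_mult_group M.cancel_inv_left)
    then show "i \<otimes> b \<otimes> inv i \<otimes> inv b \<in> ?J" using t twisted_commutator_mem[OF iJ(1) b] by simp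
    have "(i \<otimes> b) \<oplus> \<ominus> (i \<oplus> b) = \<zero>" using b ic lam[OF iJ(2) b] by (simp add: mult_lam)
    then show "(i \<otimes> b) \<oplus> \<ominus> (i \<oplus> b) \<in> ?J"
      using subgroup.one_closed[OF normal_imp_subgroup[OF additive_series_normal], of "Suc (Suc k)"] by simp
  qed
  then show ?case by simp
qed

end

theorem theorem2:
  fixes B :: "('a, 'm) ring_scheme" and n :: nat
  assumes "skew_brace B"
    and "n \<ge> 1"
    and "finite (carrier (B Quot upper_central B n))"
    and "n > 1 \<Longrightarrow> derived_ideal B \<subseteq> ker_lambda B"
  shows "finite (lower_central B (n + 1))"
proof -
  interpret skew_brace B by (rule assms(1))
  obtain k where n: "n = Suc k" using assms(2) by (cases n) auto
  have "finite ((\<lambda>a. (a, \<zero>\<^bsub>B\<^esub>)) -` G.commutator_series n)"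
    by (rule finite_vimageI[OF finite_semidirect_commutator_series[OF assms(3)]]) (auto intro: injI)
  then have fin: "finite (additive_series n)"
    by (rule rev_finite_subset) (auto simp: additive_series_def)
  have "lower_central B (Suc n) \<subseteq> additive_series n"
  proof (cases "k = 0")
    case True
    then show ?thesis
      using derived_ideal_subset_additive_series n by (simp add: derived_ideal_def)
  next
    case False
    then show ?thesis
      using lower_central_subset_additive_series[OF assms(4), of k] n by auto
  qed
  then show ?thesis using finite_subset[OF _ fin] by simp
qed

end
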